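(* Let $X$ be a compact metric space, let $T\colon X\to X$ be a continuous map, and suppose that $(X,T)$ is uniquely ergodic with unique $T$-invariant Borel probability measure $\mu$. Then $$\lim_{N\to\infty}\frac{1}{N}\sum_{n=1}^N f\big(T^{\Omega(n)}x\big)=\int f\,d\mu$$ for every $x\in X$ and every $f\in C(X)$.
   Context: $\mathbb{N}=\{1,2,3,\ldots\}$. $\Omega(n)$ denotes the number of prime factors of $n\in\mathbb{N}$ counted with multiplicities (so $\Omega(1)=0$). $C(X)$ is the space of continuous complex-valued functions on $X$. A Borel probability measure $\mu$ on $X$ is $T$-invariant if $\mu(T^{-1}A)=\mu(A)$ for all Borel sets $A\subset X$; $(X,T)$ is uniquely ergodic if it admits exactly one $T$-invariant Borel probability measure. *)

theory Defs
  imports "HOL-Analysis.Analysis" "HOL-Probability.Probability_Measure"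
    "HOL-Computational_Algebra.Primes"
begin

text \<open>Prime factors are counted with multiplicity; the value at \<open>n = 0\<close> is the junk value 0.\<close>

definition num_prime_factors :: "nat \<Rightarrow> nat" where
  "num_prime_factors n = size (prime_factorization n)"

text \<open>
  The space is a subset \<open>X\<close> of a metric space, with the subspace metric; its Borel sets are the
  sets of \<open>restrict_space borel X\<close>. The map is a total function of which only the values
  on \<open>X\<close> matter, so the preimage of \<open>A\<close> under the map on \<open>X\<close> is \<open>T -` A \<inter> X\<close>.
\<close>

definition borel_prob_measure_on :: "'a::metric_space set \<Rightarrow> 'a measure \<Rightarrow> bool" where
  "borel_prob_measure_on X \<mu> \<longleftrightarrow>
     sets \<mu> = sets (restrict_space borel X) \<and> prob_space \<mu>"

definition invariant_measure :: "'a::metric_space set \<Rightarrow> ('a \<Rightarrow> 'a) \<Rightarrow> 'a measure \<Rightarrow> bool" where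
  "invariant_measure X T \<mu> \<longleftrightarrow>
     borel_prob_measure_on X \<mu> \<and>
     (\<forall>A\<in>sets (restrict_space borel X). measure \<mu> (T -` A \<inter> X) = measure \<mu> A)"

definition uniquely_ergodic :: "'a::metric_space set \<Rightarrow> ('a \<Rightarrow> 'a) \<Rightarrow> bool" where
  "uniquely_ergodic X T \<longleftrightarrow> (\<exists>!\<mu>. invariant_measure X T \<mu>)"

end

theory Submission
  imports Defs "HOL-Real_Asymp.Real_Asymp"
begin

text \<open>
  By the Turan-Kubilius inequality, the mean of \<open>b (\<Omega> n)\<close> over \<open>n \<le> x\<close> is nearly an average, over
  any set of primes \<open>p\<close> with large \<open>\<Sum>1/p\<close>, of the means of \<open>b (\<Omega> n + 1)\<close> over \<open>n \<le> x/p\<close>. In the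
  variable \<open>ln x\<close>, the limits of such means are bounded Lipschitz functions \<open>S j t\<close> such that
  \<open>S j t\<close> is nearly the average of \<open>S (j + 1) (t - ln p)\<close>. The increments \<open>S j t - S (j + 1) t\<close>
  obey a maximum principle: if one is nearly maximal at \<open>(j, t)\<close>, then it is nearly
  maximal at \<open>(j + 1, t - ln p)\<close> for all primes \<open>p\<close> outside a set on which \<open>\<Sum>1/p\<close> is bounded. The
  numbers \<open>ln p\<close> do not concentrate near an arithmetic progression, so increments are nearly
  maximal on arbitrarily long intervals of \<open>t\<close>, and then at one \<open>t\<close> for many consecutive \<open>j\<close>.
  As these increments telescope and \<open>S\<close> is bounded, the maximum is 0.

  Consequently a limit point of the empirical distributions of \<open>T\<^sup>\<Omega>\<^sup>(\<^sup>n\<^sup>) x\<close>, taken as set functions on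
  all subsets, is a finitely additive \<open>T\<close>-invariant probability. Its regularization is an invariant
  Borel measure, hence equal to \<open>\<mu>\<close>.
\<close>

section \<open>Primes\<close>

lemma sum_inverse_smooth_le:
  assumes "finite P" and "\<And>p. p \<in> P \<Longrightarrow> prime (p::nat)"
  shows "(\<Sum>n | n \<in> {1..N} \<and> prime_factors n \<subseteq> P. 1 / real n) \<le> (\<Prod>p\<in>P. real p / (real p - 1))"
  using assms
proof (induction P rule: finite_induct)
  case empty
  have "{n. n \<in> {1..N} \<and> prime_factors n \<subseteq> {}} \<subseteq> {1}"
    by (auto simp: prime_factorization_empty_iff)
  then have "(\<Sum>n | n \<in> {1..N} \<and> prime_factors n \<subseteq> {}. 1 / real n) \<le> (\<Sum>n\<in>{1::nat}. 1 / real n)"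
    by (intro sum_mono2) auto
  then show ?case by simp
next
  case (insert q P)
  define A where "A Q = {n. n \<in> {1..N} \<and> prime_factors n \<subseteq> Q}" for Q :: "nat set"
  have fin: "finite (A Q)" for Q unfolding A_def by simp
  have q: "prime q" "q \<ge> 2" using insert.prems prime_ge_2_nat by auto
  \<comment> \<open>The multiples of \<open>q\<close> are \<open>q\<close> times elements of the
    same set, so the sum reappears on the right divided by \<open>q\<close>; solving for it produces
    the Euler factor \<open>q / (q - 1)\<close>.\<close>
  have sub: "A (insert q P) \<subseteq> A P \<union> (\<lambda>m. q * m) ` A (insert q P)"
  proof
    fix n assume n: "n \<in> A (insert q P)"
    show "n \<in> A P \<union> (\<lambda>m. q * m) ` A (insert q P)"
    proof (cases "q dvd n")
      case True
      then obtain m where m: "n = q * m" by blast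
      with n q have "m \<noteq> 0" "m \<le> n" by (auto simp: A_def)
      moreover have "prime_factors m \<subseteq> prime_factors n"
        using m n by (intro dvd_prime_factors) (auto simp: A_def)
      ultimately have "m \<in> A (insert q P)" using n by (auto simp: A_def)
      with m show ?thesis by blast
    next
      case False
      then have "q \<notin> prime_factors n" by auto
      with n show ?thesis by (auto simp: A_def)
    qed
  qed
  define s where "s Q = (\<Sum>n\<in>A Q. 1 / real n)" for Q
  have "s (insert q P) \<le> (\<Sum>n\<in>A P \<union> (\<lambda>m. q * m) ` A (insert q P). 1 / real n)"
    unfolding s_def using sub fin by (intro sum_mono2) auto
  also have "\<dots> \<le> s P + (\<Sum>n\<in>(\<lambda>m. q * m) ` A (insert q P). 1 / real n)"
    unfolding s_def using fin by (simp add: sum_Un sum_nonneg)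
  also have "(\<Sum>n\<in>(\<lambda>m. q * m) ` A (insert q P). 1 / real n) = s (insert q P) / real q"
    using q by (subst sum.reindex) (auto simp: inj_on_def s_def sum_divide_distrib field_simps)
  finally have "s (insert q P) * (1 - 1 / real q) \<le> s P" by (simp add: algebra_simps)
  then have "s (insert q P) \<le> s P * (real q / (real q - 1))"
    using q by (simp add: field_simps)
  also have "\<dots> \<le> (\<Prod>p\<in>P. real p / (real p - 1)) * (real q / (real q - 1))"
    using insert q by (intro mult_right_mono) (auto simp: s_def A_def)
  finally show ?case using insert by (simp add: s_def A_def mult.commute)
qed

text \<open>Every \<open>n \<le> N\<close> is a product of primes up to \<open>N\<close>, so the
  harmonic sum is at most an Euler product, and logarithms are taken twice. The constant 1/2 comes
  from the crude estimate \<open>p / (p - 1) \<le> exp (2 / p)\<close>.\<close>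

lemma sum_inverse_primes_ge:
  assumes "N \<ge> 1"
  shows "ln (ln (real N + 1)) / 2 \<le> (\<Sum>p | prime p \<and> p \<le> N. 1 / real p)"
proof -
  let ?P = "{p. prime p \<and> p \<le> N}"
  have fin: "finite ?P" by (rule finite_subset[of _ "{..N}"]) auto
  have "ln (real N + 1) \<le> (\<Sum>n\<in>{1..N}. 1 / real n)"
    using ln_le_harm[of N] by (simp add: harm_def inverse_eq_divide)
  also have "{1..N} = {n. n \<in> {1..N} \<and> prime_factors n \<subseteq> ?P}"
    by (auto dest!: dvd_imp_le simp: in_prime_factors_iff)
  also have "(\<Sum>n\<in>\<dots>. 1 / real n) \<le> (\<Prod>p\<in>?P. real p / (real p - 1))"
    by (rule sum_inverse_smooth_le) (use fin in auto)
  also have "\<dots> \<le> (\<Prod>p\<in>?P. exp (2 / real p))"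
  proof (rule prod_mono)
    fix p assume "p \<in> ?P"
    then have p: "real p \<ge> 2" using prime_ge_2_nat[of p] by simp
    have "real p / (real p - 1) = 1 + 1 / (real p - 1)" using p by (simp add: field_simps)
    also have "\<dots> \<le> exp (1 / (real p - 1))" by (rule exp_ge_add_one_self)
    also have "\<dots> \<le> exp (2 / real p)" using p by (simp add: field_simps)
    finally show "0 \<le> real p / (real p - 1) \<and> real p / (real p - 1) \<le> exp (2 / real p)"
      using p by simp
  qed
  also have "\<dots> = exp (2 * (\<Sum>p\<in>?P. 1 / real p))"
    using fin by (simp add: exp_sum sum_distrib_left)
  finally have "ln (ln (real N + 1)) \<le> 2 * (\<Sum>p\<in>?P. 1 / real p)"
    using assms by (subst ln_le_cancel_iff[symmetric, of _ "exp _", unfolded ln_exp, symmetric]) 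
      (auto simp: ln_ge_iff intro: ln_gt_zero)
  then show ?thesis by simp
qed

section \<open>Primes in short intervals\<close>

lemma binomial_le_exp:
  assumes "0 < y" "y \<le> (1::real)" "k \<le> n"
  shows "real (n choose k) \<le> exp (real n * y + real k * ln (1 / y))"
proof -
  have "real (n choose k) * y ^ k \<le> (\<Sum>i\<le>n. real (n choose i) * y ^ i)"
    using assms by (intro member_le_sum) auto
  also have "\<dots> = (1 + y) ^ n" by (subst add.commute, subst binomial_ring) simp
  also have "\<dots> \<le> exp y ^ n" using assms by (intro power_mono) auto
  also have "\<dots> = exp (real n * y)" by (simp add: exp_of_nat_mult)
  finally have "real (n choose k) \<le> exp (real n * y) / y ^ k"
    using assms by (simp add: field_simps)
  also have "y ^ k = exp (- (real k * ln (1 / y)))"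
    using assms by (simp add: ln_div exp_of_nat_mult)
  finally show ?thesis by (simp add: exp_minus exp_add field_simps)
qed

lemma prod_primes_dvd:
  assumes "finite P" and "\<And>p. p \<in> P \<Longrightarrow> prime (p::nat) \<and> p dvd n"
  shows "\<Prod>P dvd n"
  using assms
proof (induction P rule: finite_induct)
  case (insert q P)
  have "coprime q (\<Prod>P)"
    using insert by (intro prod_coprime_right primes_coprime) auto
  with insert show ?case by (simp add: divides_mult)
qed simp

text \<open>A prime in \<open>(m, m + k]\<close> divides \<open>(m + k)!\<close>, but exceeds both
  \<open>k\<close> and \<open>m\<close>, so it divides the binomial coefficient
  \<open>(m + k choose k)\<close>. Hence \<open>m\<close> to the number of these primes is at most
  that coefficient, which \<open>binomial_le_exp\<close> bounds with \<open>y\<close> as a free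
  parameter.\<close>

lemma card_primes_interval_le:
  assumes "k \<le> m" "0 < y" "y \<le> (1::real)" "m \<ge> 1"
  shows "real (card {p. prime p \<and> m < p \<and> p \<le> m + k}) * ln (real m)
           \<le> 2 * real m * y + real k * ln (1 / y)"
proof -
  let ?P = "{p. prime p \<and> m < p \<and> p \<le> m + k}"
  have fin: "finite ?P" by (rule finite_subset[of _ "{..m+k}"]) auto
  have "p dvd (m + k choose k)" if "p \<in> ?P" for p
  proof -
    have "fact k * fact m * (m + k choose k) = (fact (m + k) :: nat)"
      using binomial_fact_lemma[of k "m + k"] by simp
    moreover have "p dvd fact (m + k)" "\<not> p dvd fact k" "\<not> p dvd fact m"
      using that assms by (auto simp: prime_dvd_fact_iff)
    ultimately show ?thesis using that by (metis (no_types, lifting) mem_Collect_eq prime_dvd_mult_iff)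
  qed
  then have "\<Prod>?P dvd (m + k choose k)"
    using fin by (intro prod_primes_dvd) auto
  then have "\<Prod>?P \<le> (m + k choose k)" by (intro dvd_imp_le) auto
  moreover have "m ^ card ?P \<le> \<Prod>?P"
    using prod_mono[of ?P "\<lambda>_. m" "\<lambda>p. p"] by simp
  ultimately have "m ^ card ?P \<le> (m + k choose k)" by linarith
  then have "real m ^ card ?P \<le> real (m + k choose k)" by (metis of_nat_le_iff of_nat_power)
  also have "\<dots> \<le> exp (real (m + k) * y + real k * ln (1 / y))"
    using assms by (intro binomial_le_exp) auto
  finally have "ln (real m ^ card ?P) \<le> real (m + k) * y + real k * ln (1 / y)"
    using assms by (subst ln_le_cancel_iff[symmetric, of _ "exp _", unfolded ln_exp, symmetric]) auto
  moreover have "real (m + k) * y \<le> 2 * real m * y" using assms by simp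
  ultimately have "ln (real m ^ card ?P) \<le> 2 * real m * y + real k * ln (1 / y)" by linarith
  then show ?thesis using assms by (simp add: ln_realpow)
qed

text \<open>The primes of \<open>G\<close> lie between \<open>m\<close> and
  \<open>m * exp \<delta>\<close>, an interval of length at most \<open>2 * \<delta> * m\<close>, to
  which the previous bound applies with \<open>y = \<delta>\<close>. The gain is that
  \<open>\<delta> * ln (1 / \<delta>)\<close> tends to 0: a narrow cluster of logarithms carries
  little weight.\<close>

lemma sum_inverse_primes_cluster_le:
  assumes \<delta>: "0 < \<delta>" "\<delta> \<le> 1/2" and "finite G" and m: "m \<ge> (2::nat)"
    and G: "\<And>p. p \<in> G \<Longrightarrow> prime p \<and> m \<le> p \<and> ln (real p) - ln (real m) \<le> \<delta>"
  shows "(\<Sum>p\<in>G. 1 / real p) \<le> 1 / real m + 2 * \<delta> * (1 + ln (1 / \<delta>)) / ln (real m)"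
proof -
  define k where "k = nat \<lfloor>real m * (exp \<delta> - 1)\<rfloor>"
  let ?P = "{p. prime p \<and> m < p \<and> p \<le> m + k}"
  have finP: "finite ?P" by (rule finite_subset[of _ "{..m+k}"]) auto
  have "\<delta> * \<delta> \<le> \<delta>" using \<delta> mult_left_mono[of \<delta> 1 \<delta>] by simp
  then have e: "exp \<delta> - 1 \<le> 2 * \<delta>"
    using exp_bound[of \<delta>] \<delta> unfolding power2_eq_square by linarith
  have "real k \<le> real m * (exp \<delta> - 1)"
    unfolding k_def using \<delta> by simp
  also have "\<dots> \<le> real m * (2 * \<delta>)" using e by (intro mult_left_mono) auto
  finally have k: "real k \<le> 2 * \<delta> * real m" by (simp add: mult_ac)
  also have "\<dots> \<le> real m" using \<delta> m by simp
  finally have km: "k \<le> m" by simp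
  \<comment> \<open>The half-open interval counted by \<open>card_primes_interval_le\<close> omits
    \<open>m\<close> itself, which causes the term \<open>1 / m\<close>.\<close>
  have sub: "G \<subseteq> insert m ?P"
  proof
    fix p assume p: "p \<in> G"
    then have "ln (real p) \<le> ln (real m * exp \<delta>)" using G[OF p] m by (simp add: ln_mult)
    then have "real p \<le> real m * exp \<delta>" using G[OF p] m by simp
    then have "real p - real m \<le> real m * (exp \<delta> - 1)" by (simp add: algebra_simps)
    then have "int p - int m \<le> \<lfloor>real m * (exp \<delta> - 1)\<rfloor>" by (simp add: le_floor_iff)
    then have "p \<le> m + k" unfolding k_def by linarith
    then show "p \<in> insert m ?P" using G[OF p] by auto
  qed
  have "(\<Sum>p\<in>G. 1 / real p) \<le> (\<Sum>p\<in>insert m ?P. 1 / real p)"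
    using sub finP by (intro sum_mono2) auto
  also have "\<dots> = 1 / real m + (\<Sum>p\<in>?P. 1 / real p)" using finP by simp
  also have "(\<Sum>p\<in>?P. 1 / real p) \<le> (\<Sum>p\<in>?P. 1 / real m)"
    using m by (intro sum_mono) (auto simp: field_simps)
  also have "\<dots> = real (card ?P) * ln (real m) / (real m * ln (real m))" using m by simp
  also have "\<dots> \<le> (2 * real m * \<delta> + real k * ln (1 / \<delta>)) / (real m * ln (real m))"
    using m \<delta> km by (intro divide_right_mono card_primes_interval_le) auto
  also have "\<dots> \<le> (2 * real m * \<delta> + 2 * \<delta> * real m * ln (1 / \<delta>)) / (real m * ln (real m))"
    using m \<delta> k by (intro divide_right_mono add_left_mono mult_right_mono) auto
  also have "\<dots> = 2 * \<delta> * (1 + ln (1 / \<delta>)) / ln (real m)"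
    using m by (simp add: field_simps)
  finally show ?thesis by simp
qed

lemma harm_le_ln:
  assumes "n \<ge> 1" shows "harm n \<le> 1 + ln (real n)"
  using euler_mascheroni_sequence_decreasing[of 1 n] assms by (simp add: harm_expand)

text \<open>
  If the primes off \<open>B\<close> had no two logarithms at distance between \<open>\<delta>\<close> and \<open>\<epsilon>\<close>, then in each
  interval of length \<open>\<epsilon>\<close> their logarithms would lie in an interval of length \<open>\<delta>\<close>, and the
  sum of \<open>1/p\<close> up to \<open>N\<close> would be at most about \<open>ln (ln N) / 4\<close>.
\<close>

lemma close_primes_outside_thin_set:
  assumes "\<epsilon> > (0::real)"
  shows "\<exists>\<delta>. 0 < \<delta> \<and> \<delta> \<le> \<epsilon> \<and> (\<forall>B H. (\<forall>P. finite P \<longrightarrow> (\<forall>p\<in>P. prime p \<and> p \<in> B) \<longrightarrow> (\<Sum>p\<in>P. 1 / real p) \<le> H)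
     \<longrightarrow> (\<exists>p q. prime p \<and> prime q \<and> p \<notin> B \<and> q \<notin> B \<and> 
                 \<delta> \<le> ln (real q) - ln (real p) \<and> ln (real q) - ln (real p) \<le> \<epsilon>))"
proof -
  \<comment> \<open>This choice makes a cluster in the window
    \<open>[i * \<epsilon>, (i + 1) * \<epsilon>)\<close> weigh at most \<open>1 / (4 * i)\<close>
    apart from its first prime. Summed over windows this has coefficient 1/4 before
    \<open>ln (ln N)\<close>, less than the 1/2 of \<open>sum_inverse_primes_ge\<close>.\<close>
  have "((\<lambda>\<delta>::real. 2 * \<delta> * (1 + ln (1 / \<delta>))) \<longlongrightarrow> 0) (at_right 0)" by real_asymp
  then have "\<forall>\<^sub>F \<delta> in at_right 0. 2 * \<delta> * (1 + ln (1 / \<delta>)) < \<epsilon> / 4"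
    by (rule order_tendstoD) (use assms in auto)
  moreover have "\<forall>\<^sub>F \<delta> in at_right 0. 0 < \<delta> \<and> \<delta> < min (1/2) \<epsilon>"
    using assms by (intro eventually_at_rightI[of 0 "min (1/2) \<epsilon>"]) auto
  ultimately have "\<forall>\<^sub>F \<delta>::real in at_right 0. 2 * \<delta> * (1 + ln (1 / \<delta>)) < \<epsilon> / 4 \<and> 0 < \<delta> \<and> \<delta> < min (1/2) \<epsilon>"
    by eventually_elim auto
  then obtain \<delta> :: real where \<delta>: "2 * \<delta> * (1 + ln (1 / \<delta>)) < \<epsilon> / 4" "0 < \<delta>" "\<delta> \<le> 1/2" "\<delta> \<le> \<epsilon>"
    using eventually_happens by fastforce
  show ?thesis
  proof (intro exI[of _ \<delta>] conjI allI impI \<delta>)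
    fix B :: "nat set" and H :: real
    assume thin: "\<forall>P. finite P \<longrightarrow> (\<forall>p\<in>P. prime p \<and> p \<in> B) \<longrightarrow> (\<Sum>p\<in>P. 1 / real p) \<le> H"
    show "\<exists>p q. prime p \<and> prime q \<and> p \<notin> B \<and> q \<notin> B \<and> 
                 \<delta> \<le> ln (real q) - ln (real p) \<and> ln (real q) - ln (real p) \<le> \<epsilon>"
    proof (rule ccontr)
      assume no_pair: "\<not> ?thesis"
      define q where "q = exp (-\<epsilon>)"
      have q: "0 < q" "q < 1" using assms by (auto simp: q_def)
      \<comment> \<open>The bounded contributions: the primes in \<open>B\<close>, window 0, the
        geometric series from the first primes of the windows, and the constants left by
        \<open>harm I \<le> 1 + ln I\<close> with \<open>I \<le> ln N / \<epsilon>\<close>.\<close>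
      define C where "C = H + (1/2 + \<epsilon> / (4 * ln 2)) + 1 / (1 - q) + (1 - ln \<epsilon>) / 4"
      have main: "ln (ln (real N + 1)) \<le> 4 * C" if N: "real N \<ge> exp \<epsilon>" for N
      proof -
        have N1: "N \<ge> 1" using N assms by (metis One_nat_def Suc_leI exp_gt_zero gr0I not_less of_nat_0)
        define idx where "idx p = nat \<lfloor>ln (real p) / \<epsilon>\<rfloor>" for p :: nat
        define I where "I = idx N"
        have lnN: "ln (real N) \<ge> \<epsilon>" using N N1 by (simp add: ln_ge_iff)
        have N2: "N > 1" using lnN assms N1 by (cases "N = 1") auto
        have I1: "I \<ge> 1" unfolding I_def idx_def using lnN assms by (simp add: le_nat_iff)
        have I: "real I \<le> ln (real N) / \<epsilon>" unfolding I_def idx_def using lnN assms by simp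
        define G where "G = {p. prime p \<and> p \<le> N \<and> p \<notin> B}"
        define W where "W i = {p \<in> G. idx p = i}" for i
        have finG: "finite G" unfolding G_def by (rule finite_subset[of _ "{..N}"]) auto
        then have finW: "finite (W i)" for i unfolding W_def by auto
        have idx: "real (idx p) * \<epsilon> \<le> ln (real p)" "ln (real p) < real (idx p) * \<epsilon> + \<epsilon>" if "prime p" for p
        proof -
          have "ln (real p) \<ge> 0" using prime_ge_1_nat[OF that] by simp
          then have "real (idx p) = of_int \<lfloor>ln (real p) / \<epsilon>\<rfloor>"
            unfolding idx_def using assms by simp
          then have "real (idx p) \<le> ln (real p) / \<epsilon>" "ln (real p) / \<epsilon> < real (idx p) + 1"
            by linarith+
          then show "real (idx p) * \<epsilon> \<le> ln (real p)" "ln (real p) < real (idx p) * \<epsilon> + \<epsilon>"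
            using assms by (auto simp: field_simps)
        qed
        \<comment> \<open>All logarithms in a window are within \<open>\<epsilon>\<close> of that of
          its least prime \<open>m\<close>; as no pair has distance between \<open>\<delta>\<close>
          and \<open>\<epsilon>\<close>, they are within \<open>\<delta>\<close> of it.\<close>
        have cluster: "\<exists>m\<ge>2. real i * \<epsilon> \<le> ln (real m) \<and>
             (\<Sum>p\<in>W i. 1 / real p) \<le> 1 / real m + (\<epsilon> / 4) / ln (real m)"
          if ne: "W i \<noteq> {}" for i
        proof -
          define m where "m = Min (W i)"
          have mW: "m \<in> W i" unfolding m_def using finW ne by (rule Min_in)
          have m: "prime m" "m \<ge> 2" using mW prime_ge_2_nat by (auto simp: W_def G_def)
          have "(\<Sum>p\<in>W i. 1 / real p) \<le> 1 / real m + 2 * \<delta> * (1 + ln (1 / \<delta>)) / ln (real m)"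
          proof (rule sum_inverse_primes_cluster_le[OF \<delta>(2,3) finW m(2)])
            fix p assume p: "p \<in> W i"
            have "prime p" using p by (auto simp: W_def G_def)
            moreover have "m \<le> p" unfolding m_def using finW p by (rule Min_le)
            moreover have "ln (real p) - ln (real m) < \<epsilon>"
              using idx(1)[of m] idx(2)[of p] p mW by (auto simp: W_def G_def)
            moreover have "\<not> (\<delta> \<le> ln (real p) - ln (real m) \<and> ln (real p) - ln (real m) \<le> \<epsilon>)"
              using no_pair p mW by (auto simp: W_def G_def)
            ultimately show "prime p \<and> m \<le> p \<and> ln (real p) - ln (real m) \<le> \<delta>" by linarith
          qed
          also have "\<dots> \<le> 1 / real m + (\<epsilon> / 4) / ln (real m)"
            using \<delta> m by (intro add_left_mono divide_right_mono) auto
          finally have "(\<Sum>p\<in>W i. 1 / real p) \<le> 1 / real m + (\<epsilon> / 4) / ln (real m)" .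
          moreover have "real i * \<epsilon> \<le> ln (real m)" using idx(1)[of m] mW by (auto simp: W_def G_def)
          ultimately show ?thesis using m by blast
        qed
        \<comment> \<open>For \<open>i = 0\<close> the bound
          \<open>ln m \<ge> i * \<epsilon>\<close> says nothing, so \<open>m \<ge> 2\<close> is used
          in its place.\<close>
        have W0: "(\<Sum>p\<in>W 0. 1 / real p) \<le> 1/2 + \<epsilon> / (4 * ln 2)"
        proof (cases "W 0 = {}")
          case False
          then obtain m where m: "m \<ge> 2" "(\<Sum>p\<in>W 0. 1 / real p) \<le> 1 / real m + (\<epsilon> / 4) / ln (real m)"
            using cluster by blast
          have "1 / real m \<le> 1 / 2" "(\<epsilon> / 4) / ln (real m) \<le> (\<epsilon> / 4) / ln 2"
            using m assms by (auto intro!: divide_left_mono frac_le)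
          then show ?thesis using m(2) unfolding divide_divide_eq_left by linarith
        qed (use assms in auto)
        have Wi: "(\<Sum>p\<in>W i. 1 / real p) \<le> q ^ i + (1/4) * inverse (real i)" if "i \<ge> 1" for i
        proof (cases "W i = {}")
          case False
          then obtain m where m: "m \<ge> 2" "real i * \<epsilon> \<le> ln (real m)"
              "(\<Sum>p\<in>W i. 1 / real p) \<le> 1 / real m + (\<epsilon> / 4) / ln (real m)"
            using cluster by blast
          have "exp (real i * \<epsilon>) \<le> real m" using m by (subst ln_ge_iff[symmetric]) auto
          then have "1 / real m \<le> 1 / exp (real i * \<epsilon>)" using m by (intro divide_left_mono) auto
          also have "\<dots> = q ^ i" 
            unfolding q_def by (simp add: exp_minus exp_of_nat_mult divide_inverse power_inverse)
          finally have "1 / real m \<le> q ^ i" .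
          moreover have "(\<epsilon> / 4) / ln (real m) \<le> (\<epsilon> / 4) / (real i * \<epsilon>)"
            using m that assms by (intro divide_left_mono mult_pos_pos) auto
          moreover have "(\<epsilon> / 4) / (real i * \<epsilon>) = (1/4) * inverse (real i)"
            using assms that by (simp add: field_simps)
          ultimately show ?thesis using m(3) by linarith
        qed (use q in auto)
        have "(\<Sum>p\<in>G. 1 / real p) = (\<Sum>i\<in>{..I}. \<Sum>p\<in>W i. 1 / real p)"
        proof -
          have "idx p \<le> I" if "p \<in> G" for p
            using that assms prime_gt_0_nat[of p] unfolding I_def idx_def G_def
            by (auto intro!: nat_mono floor_mono divide_right_mono)
          then have "idx ` G \<subseteq> {..I}" by auto
          then show ?thesis unfolding W_def using finG by (intro sum.group[symmetric]) auto
        qed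
        also have "{..I} = insert 0 {1..I}" by auto
        also have "(\<Sum>i\<in>insert 0 {1..I}. \<Sum>p\<in>W i. 1 / real p)
            = (\<Sum>p\<in>W 0. 1 / real p) + (\<Sum>i\<in>{1..I}. \<Sum>p\<in>W i. 1 / real p)" by simp
        also have "\<dots> \<le> (1/2 + \<epsilon> / (4 * ln 2)) + (\<Sum>i\<in>{1..I}. q ^ i + (1/4) * inverse (real i))"
          using W0 Wi by (intro add_mono sum_mono) auto
        also have "(\<Sum>i\<in>{1..I}. q ^ i + (1/4) * inverse (real i)) = (\<Sum>i\<in>{1..I}. q ^ i) + (1/4) * harm I"
          by (simp add: harm_def sum.distrib sum_distrib_left)
        also have "(\<Sum>i\<in>{1..I}. q ^ i) \<le> (\<Sum>i. q ^ i)"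
          using q by (intro sum_le_suminf) auto
        also have "\<dots> = 1 / (1 - q)" using q by (intro suminf_geometric) auto
        also have "harm I \<le> 1 + ln (real I)" using I1 by (rule harm_le_ln)
        also have "ln (real I) \<le> ln (ln (real N) / \<epsilon>)" using I I1 by simp
        also have "\<dots> = ln (ln (real N)) - ln \<epsilon>" using lnN assms by (simp add: ln_div)
        also have "ln (ln (real N)) \<le> ln (ln (real N + 1))" using N2 by (intro ln_mono) auto
        finally have G_le: "(\<Sum>p\<in>G. 1 / real p) \<le> (C - H) + ln (ln (real N + 1)) / 4"
          by (simp add: C_def field_simps)
        have "ln (ln (real N + 1)) / 2 \<le> (\<Sum>p | prime p \<and> p \<le> N. 1 / real p)"
          by (rule sum_inverse_primes_ge[OF N1])
        also have "{p. prime p \<and> p \<le> N} = G \<union> {p. prime p \<and> p \<le> N \<and> p \<in> B}" by (auto simp: G_def)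
        also have "(\<Sum>p\<in>\<dots>. 1 / real p) = (\<Sum>p\<in>G. 1 / real p) + (\<Sum>p | prime p \<and> p \<le> N \<and> p \<in> B. 1 / real p)"
          using finG by (intro sum.union_disjoint) (auto simp: G_def)
        also have "(\<Sum>p | prime p \<and> p \<le> N \<and> p \<in> B. 1 / real p) \<le> H"
          using thin by auto
        finally show ?thesis using G_le by simp
      qed
      have "filterlim (\<lambda>N. ln (ln (real N + 1))) at_top sequentially" by real_asymp
      then have "\<forall>\<^sub>F N in sequentially. ln (ln (real N + 1)) > 4 * C"
        by (simp add: filterlim_at_top_dense)
      moreover have "\<forall>\<^sub>F N in sequentially. real N \<ge> exp \<epsilon>" by real_asymp
      ultimately have "\<forall>\<^sub>F N in sequentially. False"
        by eventually_elim (use main in fastforce)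
      then show False by simp
    qed
  qed
qed

lemma sum_inverse_primes_unbounded:
  "\<exists>X. (\<Sum>p | prime p \<and> p \<le> X. 1 / real p) > H"
proof -
  have "filterlim (\<lambda>N. ln (ln (real N + 1)) / 2) at_top sequentially" by real_asymp
  then have "\<forall>\<^sub>F N in sequentially. ln (ln (real N + 1)) / 2 > H \<and> N \<ge> 1"
    by (auto simp: filterlim_at_top_dense eventually_conj_iff eventually_ge_at_top)
  then obtain N where "ln (ln (real N + 1)) / 2 > H" "N \<ge> 1"
    by (auto dest: eventually_happens)
  with sum_inverse_primes_ge[of N] show ?thesis by (intro exI[of _ N]) auto
qed

section \<open>A maximum principle\<close>

text \<open>
  \<open>prime_harmonic S\<close> holds for every limit, as \<open>u\<close> tends to infinity, of the functions sending
  \<open>j, t\<close> to the mean of \<open>a (\<Omega> n + j)\<close> over \<open>n \<le> exp (u + t)\<close>, where \<open>\<bar>a\<bar> \<le> 1\<close>; the last clause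
  is then the Turan-Kubilius inequality.
\<close>

definition prime_harmonic :: "(nat \<Rightarrow> real \<Rightarrow> real) \<Rightarrow> bool" where
  "prime_harmonic S \<longleftrightarrow>
     (\<forall>j t. \<bar>S j t\<bar> \<le> 1) \<and>
     (\<forall>j s t. \<bar>S j s - S j t\<bar> \<le> 2 * \<bar>s - t\<bar>) \<and>
     (\<forall>j t P. finite P \<longrightarrow> P \<noteq> {} \<longrightarrow> (\<forall>p\<in>P. prime p) \<longrightarrow>
        \<bar>S j t - (\<Sum>p\<in>P. S (Suc j) (t - ln (real p)) / real p) / (\<Sum>p\<in>P. 1 / real p)\<bar>
          \<le> 1 / sqrt (\<Sum>p\<in>P. 1 / real p))"

lemma prime_harmonicD:
  assumes "prime_harmonic S"
  shows prime_harmonic_bounded: "\<bar>S j t\<bar> \<le> 1"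
    and prime_harmonic_lipschitz: "\<bar>S j s - S j t\<bar> \<le> 2 * \<bar>s - t\<bar>"
    and prime_harmonic_average: "finite P \<Longrightarrow> P \<noteq> {} \<Longrightarrow> (\<And>p. p \<in> P \<Longrightarrow> prime p) \<Longrightarrow>
        \<bar>S j t - (\<Sum>p\<in>P. S (Suc j) (t - ln (real p)) / real p) / (\<Sum>p\<in>P. 1 / real p)\<bar>
          \<le> 1 / sqrt (\<Sum>p\<in>P. 1 / real p)"
  using assms by (simp_all add: prime_harmonic_def)

section \<open>Increments and their supremum\<close>

definition increment :: "(nat \<Rightarrow> real \<Rightarrow> real) \<Rightarrow> nat \<Rightarrow> real \<Rightarrow> real" where
  "increment S j t = S j t - S (Suc j) t"

lemma prime_harmonic_translate:
  assumes "prime_harmonic S"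
  shows "prime_harmonic (\<lambda>j t. S (j + i) (t + s))"
proof -
  have "\<bar>S (j + i) (t + s) - (\<Sum>p\<in>P. S (Suc j + i) (t - ln (real p) + s) / real p) / (\<Sum>p\<in>P. 1 / real p)\<bar>
          \<le> 1 / sqrt (\<Sum>p\<in>P. 1 / real p)"
    if "finite P" "P \<noteq> {}" "\<forall>p\<in>P. prime p" for j t P
    using prime_harmonic_average[OF assms that(1,2), of "j + i" "t + s"] that
    by (simp add: algebra_simps)
  moreover have "\<bar>S (j + i) (t + s) - S (j + i) (t' + s)\<bar> \<le> 2 * \<bar>t - t'\<bar>" for j t t'
    using prime_harmonic_lipschitz[OF assms, of "j + i" "t + s" "t' + s"] by simp
  moreover have "\<bar>S (j + i) (t + s)\<bar> \<le> 1" for j t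
    by (rule prime_harmonic_bounded[OF assms])
  ultimately show ?thesis unfolding prime_harmonic_def by blast
qed

lemma prime_harmonic_uminus:
  assumes "prime_harmonic S"
  shows "prime_harmonic (\<lambda>j t. - S j t)"
proof -
  have "\<bar>- x - (\<Sum>p\<in>P. - y p / real p) / c\<bar> = \<bar>x - (\<Sum>p\<in>P. y p / real p) / c\<bar>" 
    for x y c and P :: "nat set"
    by (simp add: sum_negf)
  moreover have "\<bar>- x - - y\<bar> = \<bar>x - y\<bar>" for x y :: real by simp
  ultimately show ?thesis using assms unfolding prime_harmonic_def by simp
qed

lemma increment_translate: "increment (\<lambda>j t. S (j + i) (t + s)) j t = increment S (j + i) (t + s)"
  by (simp add: increment_def)

lemma increment_lipschitz:
  assumes "prime_harmonic S"
  shows "\<bar>increment S j s - increment S j t\<bar> \<le> 4 * \<bar>s - t\<bar>"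
  using prime_harmonic_lipschitz[OF assms, of j s t] prime_harmonic_lipschitz[OF assms, of "Suc j" s t]
  unfolding increment_def by linarith

text \<open>The supremum runs over the whole class, not over one function. The class is closed under
  shifts of \<open>j\<close> and \<open>t\<close>, so evaluating at the origin loses nothing, and
  near-maximizers may be translated freely.\<close>

definition max_increment :: real where
  "max_increment = (SUP S\<in>Collect prime_harmonic. increment S 0 0)"

lemma increment_le_max:
  assumes "prime_harmonic S"
  shows "increment S j t \<le> max_increment"
proof -
  let ?S = "\<lambda>k s. S (k + j) (s + t)"
  have "increment S' 0 0 \<le> 2" if "prime_harmonic S'" for S'
    using prime_harmonic_bounded[OF that, of 0 0] prime_harmonic_bounded[OF that, of 1 0]
    by (simp add: increment_def)
  then have "bdd_above ((\<lambda>S. increment S 0 0) ` Collect prime_harmonic)" by (auto intro!: bdd_aboveI2)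
  moreover have "?S \<in> Collect prime_harmonic" using prime_harmonic_translate[OF assms] by simp
  ultimately have "increment ?S 0 0 \<le> max_increment"
    unfolding max_increment_def by (rule cSUP_upper[rotated])
  then show ?thesis by (simp add: increment_translate)
qed

text \<open>Subtracting the averaging clauses at \<open>j\<close> and \<open>Suc j\<close> shows
  that the increment at \<open>(j, t)\<close> is, up to \<open>2 / sqrt H\<close>, the average of
  the increments at \<open>(Suc j, t - ln p)\<close>. If all of these are below the maximum by
  \<open>2 * \<eta>\<close>, then \<open>\<eta> \<le> 2 / sqrt H\<close>.\<close>

lemma near_max_increment_thin:
  assumes S: "prime_harmonic S" and \<eta>: "\<eta> > 0" and max: "increment S j t \<ge> max_increment - \<eta>"
    and P: "finite P" "\<And>p. p \<in> P \<Longrightarrow> prime p"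
           "\<And>p. p \<in> P \<Longrightarrow> increment S (Suc j) (t - ln (real p)) < max_increment - 2 * \<eta>"
  shows "(\<Sum>p\<in>P. 1 / real p) \<le> 4 / \<eta>\<^sup>2"
proof (cases "P = {}")
  case False
  define H where "H = (\<Sum>p\<in>P. 1 / real p)"
  have H: "H > 0" unfolding H_def using P False prime_gt_0_nat by (intro sum_pos) auto
  let ?av = "\<lambda>k. (\<Sum>p\<in>P. S k (t - ln (real p)) / real p) / H"
  have "\<bar>S k t - ?av (Suc k)\<bar> \<le> 1 / sqrt H" for k
    unfolding H_def using S P False by (intro prime_harmonic_average) auto
  note this[of j] this[of "Suc j"]
  moreover have "?av (Suc j) - ?av (Suc (Suc j)) = (\<Sum>p\<in>P. increment S (Suc j) (t - ln (real p)) / real p) / H"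
    by (simp add: increment_def sum_subtractf diff_divide_distrib)
  moreover have "(\<Sum>p\<in>P. increment S (Suc j) (t - ln (real p)) / real p) \<le> (\<Sum>p\<in>P. (max_increment - 2 * \<eta>) / real p)"
    using P by (intro sum_mono divide_right_mono) (auto intro: less_imp_le)
  then have "(\<Sum>p\<in>P. increment S (Suc j) (t - ln (real p)) / real p) / H \<le> max_increment - 2 * \<eta>"
    using H by (simp add: H_def sum_distrib_left divide_simps)
  ultimately have "max_increment - \<eta> \<le> max_increment - 2 * \<eta> + 2 / sqrt H"
    using max unfolding increment_def by simp
  then have "\<eta> \<le> 2 / sqrt H" by simp
  then have "sqrt H \<le> 2 / \<eta>" using H \<eta> by (simp add: field_simps)
  then have "(sqrt H)\<^sup>2 \<le> (2 / \<eta>)\<^sup>2" using H by (intro power_mono) auto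
  then show ?thesis using H by (simp add: H_def[symmetric] power_divide)
qed (use \<eta> in auto)

text \<open>A union bound over the points of \<open>Q\<close>: the primes that fail for some point
  still form a set with bounded sum of reciprocals.\<close>

lemma near_max_increments_thin:
  assumes S: "prime_harmonic S" and \<eta>: "\<eta> > 0" and Q: "finite Q"
    and max: "\<And>t. t \<in> Q \<Longrightarrow> increment S j t \<ge> max_increment - \<eta>"
    and P: "finite P" "\<And>p. p \<in> P \<Longrightarrow> prime p"
           "\<And>p. p \<in> P \<Longrightarrow> \<exists>t\<in>Q. increment S (Suc j) (t - ln (real p)) < max_increment - 2 * \<eta>"
  shows "(\<Sum>p\<in>P. 1 / real p) \<le> real (card Q) * (4 / \<eta>\<^sup>2)"
proof -
  define R where "R t = {p\<in>P. increment S (Suc j) (t - ln (real p)) < max_increment - 2 * \<eta>}" for t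
  have "(\<Sum>p\<in>P. 1 / real p) \<le> (\<Sum>p\<in>P. \<Sum>t\<in>{t\<in>Q. p \<in> R t}. 1 / real p)"
  proof (rule sum_mono)
    fix p assume p: "p \<in> P"
    then obtain t where "t \<in> Q" "p \<in> R t" using P(3) by (auto simp: R_def)
    then show "1 / real p \<le> (\<Sum>t\<in>{t\<in>Q. p \<in> R t}. 1 / real p)"
      using Q member_le_sum[of t "{t\<in>Q. p \<in> R t}" "\<lambda>_. 1 / real p"] by auto
  qed
  also have "\<dots> = (\<Sum>t\<in>Q. \<Sum>p\<in>{p\<in>P. p \<in> R t}. 1 / real p)"
    using P Q by (intro sum.swap_restrict) auto
  also have "\<dots> = (\<Sum>t\<in>Q. \<Sum>p\<in>R t. 1 / real p)"
    by (intro sum.cong) (auto simp: R_def)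
  also have "\<dots> \<le> (\<Sum>t\<in>Q. 4 / \<eta>\<^sup>2)"
  proof (rule sum_mono)
    fix t assume "t \<in> Q"
    then show "(\<Sum>p\<in>R t. 1 / real p) \<le> 4 / \<eta>\<^sup>2"
      using S \<eta> max P by (intro near_max_increment_thin[of S \<eta> j t]) (auto simp: R_def)
  qed
  finally show ?thesis by simp
qed

text \<open>The point is that \<open>\<delta>\<close> depends on \<open>\<epsilon>\<close> only,
  neither on the length \<open>r\<close> nor on the precision \<open>\<eta>\<close>, so that long
  chains cover long intervals. A chain is prolonged by one point at the price of doubling the
  error.\<close>

lemma near_max_increment_chain:
  assumes \<epsilon>: "\<epsilon> > 0"
  obtains \<delta> where "\<delta> > 0" "\<And>r \<eta>. \<eta> > 0 \<Longrightarrow>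
    \<exists>S g. prime_harmonic S \<and> g 0 = (0::real) \<and> (\<forall>i<r. \<delta> \<le> g (Suc i) - g i \<and> g (Suc i) - g i \<le> \<epsilon>)
        \<and> (\<forall>i\<le>r. increment S 0 (g i) \<ge> max_increment - \<eta>)"
proof -
  obtain \<delta> where \<delta>: "\<delta> > 0" and pair: "\<And>B H. (\<And>P. finite P \<Longrightarrow> (\<And>p. p \<in> P \<Longrightarrow> prime p \<and> p \<in> B) \<Longrightarrow> (\<Sum>p\<in>P. 1 / real p) \<le> H)
     \<Longrightarrow> \<exists>p q. prime p \<and> prime q \<and> p \<notin> B \<and> q \<notin> B \<and> 
                 \<delta> \<le> ln (real q) - ln (real p) \<and> ln (real q) - ln (real p) \<le> \<epsilon>"
    using close_primes_outside_thin_set[OF \<epsilon>] by metis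
  have "\<exists>S g. prime_harmonic S \<and> g 0 = (0::real) \<and> (\<forall>i<r. \<delta> \<le> g (Suc i) - g i \<and> g (Suc i) - g i \<le> \<epsilon>)
        \<and> (\<forall>i\<le>r. increment S 0 (g i) \<ge> max_increment - \<eta>)" if "\<eta> > 0" for r \<eta>
    using that
  proof (induction r arbitrary: \<eta>)
    case 0
    have "prime_harmonic (\<lambda>_ _. 0)" by (simp add: prime_harmonic_def sum_nonneg)
    then have "(\<lambda>S. increment S 0 0) ` Collect prime_harmonic \<noteq> {}" by blast
    then obtain S where "prime_harmonic S" "increment S 0 0 > max_increment - \<eta>"
      using less_cSupD[of "(\<lambda>S. increment S 0 0) ` Collect prime_harmonic" "max_increment - \<eta>"] 0
      by (auto simp: max_increment_def)
    then show ?case by (intro exI[of _ S] exI[of _ "\<lambda>_. 0"]) auto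
  next
    case (Suc r)
    then obtain S and g :: "nat \<Rightarrow> real" where S: "prime_harmonic S" and g: "g 0 = 0"
      "\<And>i. i < r \<Longrightarrow> \<delta> \<le> g (Suc i) - g i \<and> g (Suc i) - g i \<le> \<epsilon>"
      "\<And>i. i \<le> r \<Longrightarrow> increment S 0 (g i) \<ge> max_increment - \<eta> / 2"
      using half_gt_zero by metis
    \<comment> \<open>The primes that are bad for some point of the chain; \<open>B\<close> is thin,
      so two good primes \<open>p\<close>, \<open>q\<close> with suitably close logarithms exist
      outside it.\<close>
    define B where "B = {p. \<exists>t\<in>g ` {..r}. increment S (Suc 0) (t - ln (real p)) < max_increment - 2 * (\<eta> / 2)}"
    have "\<exists>p q. prime p \<and> prime q \<and> p \<notin> B \<and> q \<notin> B \<and> 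
                 \<delta> \<le> ln (real q) - ln (real p) \<and> ln (real q) - ln (real p) \<le> \<epsilon>"
    proof (rule pair[of _ "real (card (g ` {..r})) * (4 / (\<eta> / 2)\<^sup>2)"])
      fix P assume "finite P" "\<And>p. p \<in> P \<Longrightarrow> prime p \<and> p \<in> B"
      then show "(\<Sum>p\<in>P. 1 / real p) \<le> real (card (g ` {..r})) * (4 / (\<eta> / 2)\<^sup>2)"
        using S Suc.prems g by (intro near_max_increments_thin[where S = S and j = 0]) (auto simp: B_def)
    qed
    then obtain p q where pq: "p \<notin> B" "q \<notin> B" 
        "\<delta> \<le> ln (real q) - ln (real p)" "ln (real q) - ln (real p) \<le> \<epsilon>" by blast
    \<comment> \<open>After the shift by \<open>ln q\<close> the old points
      \<open>g i - ln q\<close> become \<open>g i\<close> again, while \<open>g r - ln p\<close>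
      becomes the new last point \<open>g r + (ln q - ln p)\<close>.\<close>
    define S' where "S' = (\<lambda>j t. S (j + 1) (t + (- ln (real q))))"
    define g' where "g' i = (if i \<le> r then g i else g r + (ln (real q) - ln (real p)))" for i
    have "prime_harmonic S'" unfolding S'_def using S by (rule prime_harmonic_translate)
    moreover have "g' 0 = 0" by (simp add: g'_def g)
    moreover have "\<delta> \<le> g' (Suc i) - g' i \<and> g' (Suc i) - g' i \<le> \<epsilon>" if "i < Suc r" for i
      using that g(2)[of i] pq by (auto simp: g'_def less_Suc_eq)
    moreover have "increment S' 0 (g' i) \<ge> max_increment - \<eta>" if "i \<le> Suc r" for i
    proof (cases "i \<le> r")
      case True
      then have "\<not> increment S (Suc 0) (g i - ln (real q)) < max_increment - 2 * (\<eta> / 2)"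
        using pq by (auto simp: B_def)
      with True show ?thesis unfolding S'_def increment_translate by (simp add: g'_def)
    next
      case False
      then have "\<not> increment S (Suc 0) (g r - ln (real p)) < max_increment - 2 * (\<eta> / 2)"
        using pq by (auto simp: B_def)
      with False show ?thesis unfolding S'_def increment_translate by (simp add: g'_def)
    qed
    ultimately show ?case by blast
  qed
  from \<delta> this show ?thesis by (rule that)
qed

text \<open>A chain of \<open>r\<close> steps of size at least \<open>\<delta>\<close> covers
  \<open>[0, 2 * L]\<close>. Its gaps are at most \<open>\<eta> / 8\<close> and increments are
  4-Lipschitz, so at most \<open>\<eta> / 2\<close> is lost between its points; a translation by
  \<open>L\<close> then centers the interval.\<close>

lemma near_max_increment_interval:
  assumes \<eta>: "\<eta> > 0"
  shows "\<exists>S. prime_harmonic S \<and> (\<forall>t. \<bar>t\<bar> \<le> L \<longrightarrow> increment S 0 t \<ge> max_increment - \<eta>)"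
proof -
  obtain \<delta> where \<delta>: "\<delta> > 0" and chain: "\<And>r \<eta>'. \<eta>' > 0 \<Longrightarrow>
    \<exists>S g. prime_harmonic S \<and> g 0 = (0::real) \<and> (\<forall>i<r. \<delta> \<le> g (Suc i) - g i \<and> g (Suc i) - g i \<le> \<eta> / 8)
        \<and> (\<forall>i\<le>r. increment S 0 (g i) \<ge> max_increment - \<eta>')"
    by (rule near_max_increment_chain[of "\<eta> / 8"]) (use \<eta> in auto)
  define r where "r = nat \<lceil>2 * L / \<delta>\<rceil>"
  obtain S and g :: "nat \<Rightarrow> real" where S: "prime_harmonic S" and g0: "g 0 = 0"
      and gap: "\<And>i. i < r \<Longrightarrow> \<delta> \<le> g (Suc i) - g i \<and> g (Suc i) - g i \<le> \<eta> / 8"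
      and big: "\<And>i. i \<le> r \<Longrightarrow> increment S 0 (g i) \<ge> max_increment - \<eta> / 2"
    using chain[of "\<eta> / 2" r] \<eta> by auto
  have g_ge: "real i * \<delta> \<le> g i" if "i \<le> r" for i
    using that
  proof (induction i)
    case (Suc i)
    then show ?case using gap[of i] by (simp add: algebra_simps)
  qed (simp add: g0)
  have "2 * L / \<delta> \<le> real r" unfolding r_def by linarith
  then have "2 * L \<le> real r * \<delta>" using \<delta> by (simp add: field_simps)
  then have gr: "2 * L \<le> g r" using g_ge[of r] by simp
  have near: "increment S 0 s \<ge> max_increment - \<eta>" if s: "0 \<le> s" "s \<le> 2 * L" for s
  proof -
    define i where "i = Max {i. i \<le> r \<and> g i \<le> s}"
    have "i \<in> {i. i \<le> r \<and> g i \<le> s}" unfolding i_def using g0 s by (intro Max_in) auto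
    then have i: "i \<le> r" "g i \<le> s" by auto
    have "s \<le> g i + \<eta> / 8"
    proof (cases "i = r")
      case True then show ?thesis using gr s \<eta> by simp
    next
      case False
      have "\<not> g (Suc i) \<le> s"
      proof
        assume "g (Suc i) \<le> s"
        then have "Suc i \<le> i" unfolding i_def using False i by (intro Max_ge) (auto simp: i_def)
        then show False by simp
      qed
      then show ?thesis using gap[of i] False i by simp
    qed
    then have "\<bar>increment S 0 s - increment S 0 (g i)\<bar> \<le> \<eta> / 2"
      using increment_lipschitz[OF S, of 0 s "g i"] i by simp
    then show ?thesis using big[OF i(1)] by linarith
  qed
  have "increment (\<lambda>j t. S (j + 0) (t + L)) 0 t \<ge> max_increment - \<eta>" if "\<bar>t\<bar> \<le> L" for t
    unfolding increment_translate using near[of "t + L"] that by simp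
  then show ?thesis using prime_harmonic_translate[OF S, of 0 L] by blast
qed

text \<open>Induction on the number of levels. Given levels up to \<open>K\<close> on a longer
  interval, one prime \<open>p\<close> is found that is good at level \<open>Suc K\<close> for all
  points of a finite net of the interval; translating by \<open>ln p\<close> keeps the lower levels
  under control because their interval was long enough.\<close>

lemma near_max_increments_interval:
  assumes "\<eta> > 0"
  shows "\<exists>S. prime_harmonic S \<and> (\<forall>j\<le>K. \<forall>t. \<bar>t\<bar> \<le> L \<longrightarrow> increment S j t \<ge> max_increment - \<eta>)"
  using assms
proof (induction K arbitrary: \<eta> L)
  case 0
  then show ?case using near_max_increment_interval[of \<eta> L] by simp
next
  case (Suc K)
  define L1 where "L1 = max L 0"
  \<comment> \<open>The mesh of the net: the Lipschitz constant 4 turns it into a loss of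
    \<open>\<eta> / 2\<close>, and the passage to the next level loses another
    \<open>2 * (\<eta> / 4)\<close>.\<close>
  define h where "h = \<eta> / 8"
  define n where "n = nat \<lceil>2 * L1 / h\<rceil>"
  define Q where "Q = (\<lambda>i. - L1 + real i * h) ` {..n}"
  define H where "H = real (card Q) * (4 / (\<eta> / 4)\<^sup>2)"
  have L1: "L1 \<ge> 0" "L \<le> L1" and h: "h > 0" using Suc.prems by (auto simp: L1_def h_def)
  have "real n \<le> 2 * L1 / h + 1" unfolding n_def using L1 h by (simp add: of_nat_ceiling)
  then have nh: "real n * h \<le> 2 * L1 + h" using h by (simp add: field_simps)
  have Q_le: "\<bar>t\<bar> \<le> L1 + \<eta>" if "t \<in> Q" for t
  proof -
    from that obtain i where i: "i \<le> n" "t = - L1 + real i * h" by (auto simp: Q_def)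
    have "real i * h \<le> real n * h" "0 \<le> real i * h" using i h by auto
    then have "- L1 \<le> t" "t \<le> L1 + h" using i(2) nh by linarith+
    moreover have "h \<le> \<eta>" using Suc.prems by (simp add: h_def)
    ultimately show ?thesis using Suc.prems by linarith
  qed
  \<comment> \<open>\<open>X\<close> depends only on the net and on \<open>\<eta>\<close>, so it can
    be fixed before \<open>S\<close>, whose interval must be longer by \<open>ln X\<close>.\<close>
  obtain X where X: "(\<Sum>p | prime p \<and> p \<le> X. 1 / real p) > H"
    using sum_inverse_primes_unbounded by blast
  obtain S where S: "prime_harmonic S"
    and big: "\<And>j t. j \<le> K \<Longrightarrow> \<bar>t\<bar> \<le> L1 + \<eta> + ln (real X) \<Longrightarrow> increment S j t \<ge> max_increment - \<eta> / 4"
    using Suc.IH[of "\<eta> / 4" "L1 + \<eta> + ln (real X)"] Suc.prems by auto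
  have lnX: "ln (real X) \<ge> 0" by (cases "X = 0") auto
  have "\<exists>p. prime p \<and> p \<le> X \<and> (\<forall>t\<in>Q. increment S (Suc K) (t - ln (real p)) \<ge> max_increment - 2 * (\<eta> / 4))"
  proof (rule ccontr)
    assume "\<not> ?thesis"
    then have bad: "\<exists>t\<in>Q. increment S (Suc K) (t - ln (real p)) < max_increment - 2 * (\<eta> / 4)"
      if "prime p" "p \<le> X" for p using that by (auto simp: not_le)
    have "(\<Sum>p | prime p \<and> p \<le> X. 1 / real p) \<le> H"
      unfolding H_def
    proof (rule near_max_increments_thin[OF S])
      show "increment S K t \<ge> max_increment - \<eta> / 4" if "t \<in> Q" for t
        using big[of K t] Q_le[OF that] lnX by simp
    qed (use bad Suc.prems in \<open>auto simp: Q_def\<close>)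
    then show False using X by simp
  qed
  then obtain p where p: "prime p" "p \<le> X"
    and good: "\<And>t. t \<in> Q \<Longrightarrow> increment S (Suc K) (t - ln (real p)) \<ge> max_increment - 2 * (\<eta> / 4)"
    by blast
  have lnp: "0 \<le> ln (real p)" "ln (real p) \<le> ln (real X)"
    using p prime_ge_1_nat[OF p(1)] by auto
  \<comment> \<open>Only \<open>t\<close> is shifted here: keeping \<open>j\<close> fixed adds level
    \<open>Suc K\<close> to the levels already treated.\<close>
  define S' where "S' = (\<lambda>j t. S (j + 0) (t + (- ln (real p))))"
  have "increment S' j t \<ge> max_increment - \<eta>" if j: "j \<le> Suc K" and t: "\<bar>t\<bar> \<le> L" for j t
  proof (cases "j \<le> K")
    case True
    then have "increment S j (t - ln (real p)) \<ge> max_increment - \<eta> / 4"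
      using lnp t L1 Suc.prems by (intro big) auto
    then show ?thesis unfolding S'_def increment_translate using Suc.prems by simp
  next
    case False
    with j have j: "j = Suc K" by simp
    define i where "i = nat \<lfloor>(t + L1) / h\<rfloor>"
    have tL: "0 \<le> (t + L1) / h" using t L1 h by auto
    have "(t + L1) / h \<le> 2 * L1 / h" using t L1 h by (intro divide_right_mono) auto
    then have "i \<le> n" unfolding i_def n_def by linarith
    define t0 where "t0 = - L1 + real i * h"
    have t0: "t0 \<in> Q" using \<open>i \<le> n\<close> by (auto simp: Q_def t0_def)
    have "real i \<le> (t + L1) / h" "(t + L1) / h \<le> real i + 1" unfolding i_def using tL by linarith+
    then have "\<bar>t - t0\<bar> \<le> h" using h by (simp add: t0_def field_simps abs_le_iff)
    moreover have "\<bar>increment S (Suc K) (t - ln (real p)) - increment S (Suc K) (t0 - ln (real p))\<bar> \<le> 4 * \<bar>t - t0\<bar>"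
      using increment_lipschitz[OF S, of "Suc K" "t - ln (real p)" "t0 - ln (real p)"] by simp
    moreover have "increment S (Suc K) (t0 - ln (real p)) \<ge> max_increment - 2 * (\<eta> / 4)" by (rule good[OF t0])
    ultimately have "increment S (Suc K) (t - ln (real p)) \<ge> max_increment - \<eta>"
      unfolding h_def by argo
    then show ?thesis using j unfolding S'_def increment_translate by simp
  qed
  moreover have "prime_harmonic S'" unfolding S'_def using S by (rule prime_harmonic_translate)
  ultimately show ?case by blast
qed

text \<open>If the maximum were positive, \<open>Suc K\<close> consecutive increments at
  \<open>t = 0\<close>, each at least half of it, would telescope to a difference of two values of
  \<open>S\<close>, which is at most 2. \<open>K\<close> is chosen so that their sum exceeds
  2.\<close>

lemma max_increment_nonpos: "max_increment \<le> 0"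
proof (rule ccontr)
  assume "\<not> max_increment \<le> 0"
  then have M: "max_increment > 0" by simp
  define K where "K = nat \<lceil>4 / max_increment\<rceil>"
  obtain S where S: "prime_harmonic S"
      and big: "\<And>j t. j \<le> K \<Longrightarrow> \<bar>t\<bar> \<le> 0 \<Longrightarrow> increment S j t \<ge> max_increment - max_increment / 2"
    using near_max_increments_interval[of "max_increment / 2" K 0] M by auto
  have "4 / max_increment \<le> real K" unfolding K_def by linarith
  then have "4 \<le> real K * max_increment" using M by (simp add: field_simps)
  then have "2 < real (Suc K) * (max_increment / 2)" using M by (simp add: algebra_simps)
  also have "\<dots> = (\<Sum>j\<le>K. max_increment / 2)" by simp
  also have "\<dots> \<le> (\<Sum>j\<le>K. increment S j 0)" using big[of _ 0] by (intro sum_mono) simp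
  also have "\<dots> = S 0 0 - S (Suc K) 0"
  proof -
    have "(\<Sum>j\<le>k. increment S j 0) = S 0 0 - S (Suc k) 0" for k
      by (induction k) (auto simp: increment_def)
    then show ?thesis .
  qed
  also have "\<dots> \<le> 2"
    using prime_harmonic_bounded[OF S, of 0 0] prime_harmonic_bounded[OF S, of "Suc K" 0] by linarith
  finally show False by simp
qed

text \<open>The class is closed under negation, so the bound on increments holds for
  \<open>S\<close> and for \<open>- S\<close>.\<close>

lemma prime_harmonic_const:
  assumes "prime_harmonic S"
  shows "S (Suc j) t = S j t"
proof -
  have "increment S j t \<le> 0" "increment (\<lambda>j t. - S j t) j t \<le> 0"
    using increment_le_max assms prime_harmonic_uminus[OF assms] max_increment_nonpos
    by (meson order_trans)+
  then show ?thesis by (simp add: increment_def)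
qed

section \<open>Means along the number of prime factors\<close>

text \<open>Tychonoff's theorem for the cube \<open>[-1, 1]\<close> to the power \<open>'i\<close>.
  A finer filter takes the place of a subsequence because the index types used later, pairs with a
  real number and sets of points, may be uncountable.\<close>

lemma bounded_net_cluster:
  fixes s :: "'b \<Rightarrow> 'i \<Rightarrow> real"
  assumes "F \<noteq> bot" and "\<And>n i. \<bar>s n i\<bar> \<le> 1"
  obtains G S where "G \<noteq> bot" "G \<le> F" "\<And>i. ((\<lambda>n. s n i) \<longlongrightarrow> S i) G"
proof -
  have "compact (PiE UNIV (\<lambda>_::'i. {-1..1::real}))"
    using compactin_PiE[of "\<lambda>_::'i. euclidean" UNIV "\<lambda>_. {-1..1::real}"]
    by (simp add: euclidean_product_topology)
  moreover have "filtermap s F \<noteq> bot" using assms(1) by (simp add: filtermap_bot_iff)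
  moreover have "eventually (\<lambda>x. x \<in> PiE UNIV (\<lambda>_. {-1..1})) (filtermap s F)"
    using assms(2) by (auto simp: eventually_filtermap PiE_UNIV_domain abs_le_iff intro!: always_eventually)
  ultimately obtain S where S: "inf (nhds S) (filtermap s F) \<noteq> bot"
    unfolding compact_filter by blast
  \<comment> \<open>\<open>F\<close> refined by the preimages of the neighborhoods of
    \<open>S\<close>; it is proper because \<open>S\<close> is a cluster point, and \<open>s\<close>
    converges to \<open>S\<close> along it by construction.\<close>
  define G where "G = inf F (filtercomap s (nhds S))"
  have "G \<noteq> bot"
  proof
    assume "G = bot"
    then have "eventually (\<lambda>_. False) G" by simp
    then obtain P Q where PQ: "eventually P F" "eventually Q (filtercomap s (nhds S))" "\<And>x. P x \<Longrightarrow> Q x \<Longrightarrow> False"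
      unfolding G_def eventually_inf by blast
    then obtain R where R: "eventually R (nhds S)" "\<And>x. R (s x) \<Longrightarrow> Q x"
      by (auto simp: eventually_filtercomap)
    have "eventually (\<lambda>y. \<not> R y) (filtermap s F)"
      unfolding eventually_filtermap using PQ(1) by eventually_elim (use PQ R in blast)
    then have "eventually (\<lambda>_. False) (inf (nhds S) (filtermap s F))"
      unfolding eventually_inf using R(1) by blast
    with S show False by (simp add: eventually_False)
  qed
  moreover have "G \<le> F" unfolding G_def by simp
  moreover have "((\<lambda>n. s n i) \<longlongrightarrow> S i) G" for i
  proof -
    have "filterlim s (nhds S) G"
      unfolding filterlim_iff_le_filtercomap G_def by simp
    moreover have "continuous_on UNIV (\<lambda>x::'i \<Rightarrow> real. x i)" by (rule continuous_on_product_coordinates)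
    ultimately have "((\<lambda>n. s n i) \<longlongrightarrow> S i) G"
      using continuous_on_tendsto_compose[of UNIV "\<lambda>x::'i \<Rightarrow> real. x i" s S G] by simp
    then 
    show ?thesis by simp
  qed
  ultimately show ?thesis using that by blast
qed

section \<open>Means on a logarithmic scale and the Turan-Kubilius inequality\<close>

definition mean :: "(nat \<Rightarrow> real) \<Rightarrow> real \<Rightarrow> real" where
  "mean b x = (\<Sum>n\<in>{1..nat \<lfloor>x\<rfloor>}. b n) / x"

lemma abs_mean_le:
  assumes "\<And>n. \<bar>b n\<bar> \<le> 1" "x > 0"
  shows "\<bar>mean b x\<bar> \<le> 1"
proof -
  have "\<bar>\<Sum>n\<in>{1..nat \<lfloor>x\<rfloor>}. b n\<bar> \<le> (\<Sum>n\<in>{1..nat \<lfloor>x\<rfloor>}. 1)"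
    using assms by (intro order_trans[OF sum_abs] sum_mono) auto
  also have "\<dots> \<le> x" using assms by simp
  finally show ?thesis using assms by (simp add: mean_def)
qed

text \<open>Source of the Lipschitz clause of \<open>prime_harmonic\<close>: both the change of
  normalization and the added terms cost \<open>1 - x / y\<close>, which is at most
  \<open>ln y - ln x\<close>. The \<open>1 / y\<close> absorbs the rounding and vanishes in the
  limit.\<close>

lemma mean_diff_le:
  assumes b: "\<And>n. \<bar>b n\<bar> \<le> 1" and x: "x > 0" "x \<le> y"
  shows "\<bar>mean b x - mean b y\<bar> \<le> 2 * (ln y - ln x) + 1 / y"
proof -
  let ?m = "nat \<lfloor>x\<rfloor>" and ?n = "nat \<lfloor>y\<rfloor>"
  let ?s = "\<lambda>x. \<Sum>n\<in>{1..nat \<lfloor>x\<rfloor>}. b n"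
  have mn: "?m \<le> ?n" using x by (intro nat_mono floor_mono)
  have "?s y = ?s x + (\<Sum>n\<in>{?m+1..?n}. b n)"
    using mn sum.ub_add_nat[of 1 ?m b "?n - ?m"] by simp
  then have "\<bar>?s y - ?s x\<bar> \<le> (\<Sum>n\<in>{?m+1..?n}. 1)"
    using b by (auto intro!: order_trans[OF sum_abs] sum_mono simp del: sum_constant)
  also have "\<dots> \<le> y - x + 1" using mn x by (simp add: of_nat_diff) linarith
  finally have d: "\<bar>?s y - ?s x\<bar> \<le> y - x + 1" .
  have "mean b x - mean b y = ?s x / x * (1 - x / y) - (?s y - ?s x) / y"
    using x by (simp add: mean_def field_simps)
  then have "\<bar>mean b x - mean b y\<bar> \<le> \<bar>?s x / x * (1 - x / y)\<bar> + \<bar>(?s y - ?s x) / y\<bar>" by linarith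
  also have "\<bar>?s x / x * (1 - x / y)\<bar> \<le> 1 * (1 - x / y)"
    using abs_mean_le[OF b x(1)] x unfolding mean_def abs_mult by (intro mult_mono) auto
  also have "\<bar>(?s y - ?s x) / y\<bar> \<le> (y - x + 1) / y"
    using d x by (simp add: abs_divide divide_right_mono)
  also have "1 * (1 - x / y) + (y - x + 1) / y = 2 * (1 - x / y) + 1 / y" using x by (simp add: field_simps)
  also have "1 - x / y \<le> ln y - ln x"
    using ln_le_minus_one[of "x / y"] x by (simp add: ln_div)
  finally show ?thesis by simp
qed

text \<open>The square is expanded. As the mixed term has the sign of \<open>- H\<close>, a lower
  bound for the first moment of the number of prime divisors in \<open>P\<close> and an upper bound
  for the second suffice; both come from counting multiples.\<close>

lemma turan_kubilius:
  fixes x :: real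
  assumes P: "finite P" "\<And>p. p \<in> P \<Longrightarrow> prime p" and x: "x \<ge> 0"
  defines "H \<equiv> \<Sum>p\<in>P. 1 / real p"
  shows "(\<Sum>n\<in>{1..nat \<lfloor>x\<rfloor>}. (H - real (card {p\<in>P. p dvd n}))\<^sup>2) \<le> H * x + 2 * H * real (card P)"
proof -
  define N where "N = nat \<lfloor>x\<rfloor>"
  define I where "I p n = (if p dvd n then 1 else 0 :: real)" for p n :: nat
  have card: "real (card {p\<in>P. p dvd n}) = (\<Sum>p\<in>P. I p n)" for n
    unfolding I_def using P by (simp add: sum.If_cases Int_def)
  have count: "(\<Sum>n\<in>{1..N}. I d n) = real (N div d)" if "d > 0" for d
  proof -
    have "(\<Sum>n\<in>{1..N}. I d n) = real (card ({1..N} \<inter> {n. d dvd n}))"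
      unfolding I_def by (simp add: sum.If_cases)
    also have "{1..N} \<inter> {n. d dvd n} = (\<lambda>k. d * k) ` {1..N div d}"
      using that by (auto simp: less_eq_div_iff_mult_less_eq mult.commute dvd_def image_iff Suc_le_eq)
    also have "card \<dots> = N div d" using that by (subst card_image) (auto simp: inj_on_def)
    finally show ?thesis .
  qed
  have div_le: "real (N div d) \<le> real N / real d" "real N / real d - 1 \<le> real (N div d)" if "d > 0" for d
  proof -
    show "real (N div d) \<le> real N / real d" by (rule of_nat_div_le_of_nat)
    have "real N = real d * real (N div d) + real (N mod d)" by (metis mult_div_mod_eq of_nat_add of_nat_mult)
    moreover have "real (N mod d) \<le> real d" using that by (simp add: less_imp_le)
    ultimately show "real N / real d - 1 \<le> real (N div d)" using that by (simp add: field_simps)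
  qed
  have pos: "p > 0" if "p \<in> P" for p using P that prime_gt_0_nat by blast
  have H0: "H \<ge> 0" unfolding H_def by (intro sum_nonneg) auto
  have "(\<Sum>n\<in>{1..N}. (\<Sum>p\<in>P. I p n)) = (\<Sum>p\<in>P. real (N div p))"
    by (subst sum.swap, rule sum.cong[OF refl], rule count, rule pos)
  also have "\<dots> \<ge> (\<Sum>p\<in>P. real N / real p - 1)" using div_le pos by (intro sum_mono) auto
  finally have first: "(\<Sum>n\<in>{1..N}. (\<Sum>p\<in>P. I p n)) \<ge> real N * H - real (card P)"
    by (simp add: H_def sum_subtractf sum_distrib_left)
  have "(\<Sum>n\<in>{1..N}. (\<Sum>p\<in>P. I p n)\<^sup>2) = (\<Sum>p\<in>P. \<Sum>q\<in>P. \<Sum>n\<in>{1..N}. I p n * I q n)"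
    unfolding power2_eq_square sum_product
    by (subst sum.swap, rule sum.cong[OF refl], subst sum.swap) simp
  also have "\<dots> \<le> (\<Sum>p\<in>P. \<Sum>q\<in>P. real N / (real p * real q) + (if p = q then real N / real p else 0))"
  proof (intro sum_mono)
    fix p q assume pq: "p \<in> P" "q \<in> P"
    show "(\<Sum>n\<in>{1..N}. I p n * I q n) \<le> real N / (real p * real q) + (if p = q then real N / real p else 0)"
    proof (cases "p = q")
      case True
      then have "(\<Sum>n\<in>{1..N}. I p n * I q n) = (\<Sum>n\<in>{1..N}. I p n)"
        by (intro sum.cong) (auto simp: I_def)
      also have "\<dots> \<le> real N / real p" using count[of p] div_le[of p] pos pq by simp
      finally show ?thesis using True by (simp add: add_increasing)
    next
      case False
      then have "coprime p q" using P pq by (intro primes_coprime) auto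
      \<comment> \<open>Distinct primes both divide \<open>n\<close> exactly when their product
        does, so these terms behave like independent events; the diagonal \<open>p = q\<close> gives
        the excess \<open>N * H\<close>.\<close>
      then have "(\<Sum>n\<in>{1..N}. I p n * I q n) = (\<Sum>n\<in>{1..N}. I (p * q) n)"
        by (intro sum.cong) (auto simp: I_def divides_mult dest: dvd_mult_left dvd_mult_right)
      then show ?thesis using False count[of "p * q"] div_le[of "p * q"] pos pq by simp
    qed
  qed
  also have "\<dots> = (\<Sum>p\<in>P. \<Sum>q\<in>P. real N * (1 / real p * (1 / real q))) + (\<Sum>p\<in>P. real N * (1 / real p))"
    using P(1) by (simp add: sum.distrib)
  also have "\<dots> = real N * H\<^sup>2 + real N * H"
    by (simp only: power2_eq_square H_def sum_product sum_distrib_left[symmetric])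
  finally have second: "(\<Sum>n\<in>{1..N}. (\<Sum>p\<in>P. I p n)\<^sup>2) \<le> real N * H\<^sup>2 + real N * H" .
  have "(\<Sum>n\<in>{1..N}. (H - (\<Sum>p\<in>P. I p n))\<^sup>2)
      = real N * H\<^sup>2 - 2 * H * (\<Sum>n\<in>{1..N}. (\<Sum>p\<in>P. I p n)) + (\<Sum>n\<in>{1..N}. (\<Sum>p\<in>P. I p n)\<^sup>2)"
    by (simp add: power2_diff sum.distrib sum_subtractf sum_distrib_left)
  also have "\<dots> \<le> real N * H\<^sup>2 - 2 * H * (real N * H - real (card P)) + (real N * H\<^sup>2 + real N * H)"
    using first second H0 by (intro add_mono diff_mono mult_left_mono) auto
  also have "\<dots> = H * real N + 2 * H * real (card P)" by (simp add: algebra_simps power2_eq_square)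
  also have "\<dots> \<le> H * x + 2 * H * real (card P)"
    using H0 x by (intro add_right_mono mult_left_mono) (auto simp: N_def)
  finally show ?thesis unfolding card N_def .
qed

text \<open>This identity is exact because \<open>mean\<close> divides by the real number
  \<open>x\<close> and not by its integer part.\<close>

lemma mean_multiples:
  fixes p :: nat
  assumes "p > 0" "x \<ge> 0"
  shows "mean (\<lambda>n. b (p * n)) (x / real p) / real p = (\<Sum>n\<in>{1..nat \<lfloor>x\<rfloor>}. if p dvd n then b n else 0) / x"
proof -
  have "\<lfloor>x / real p\<rfloor> = \<lfloor>x\<rfloor> div int p"
    using floor_divide_real_eq_div[of "int p" x] by simp
  then have fl: "nat \<lfloor>x / real p\<rfloor> = nat \<lfloor>x\<rfloor> div p"
    using assms by (simp add: nat_div_distrib)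
  have "{1..nat \<lfloor>x\<rfloor>} \<inter> {n. p dvd n} = (\<lambda>k. p * k) ` {1..nat \<lfloor>x\<rfloor> div p}"
    using assms by (auto simp: less_eq_div_iff_mult_less_eq mult.commute dvd_def image_iff Suc_le_eq)
  then have "(\<Sum>n\<in>{1..nat \<lfloor>x\<rfloor>}. if p dvd n then b n else 0) = (\<Sum>n\<in>(\<lambda>k. p * k) ` {1..nat \<lfloor>x\<rfloor> div p}. b n)"
    by (simp add: sum.If_cases)
  also have "\<dots> = (\<Sum>n\<in>{1..nat \<lfloor>x\<rfloor> div p}. b (p * n))"
    using assms by (subst sum.reindex) (auto simp: inj_on_def)
  finally show ?thesis using assms fl by (simp add: mean_def)
qed

text \<open>Summing over the multiples of each \<open>p\<close> counts \<open>b n\<close> once for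
  every prime of \<open>P\<close> dividing \<open>n\<close>, that is \<open>H - w n\<close> times.
  The error is thus the correlation of \<open>b\<close> with \<open>w\<close>, and Cauchy-Schwarz
  reduces it to \<open>turan_kubilius\<close>.\<close>

lemma mean_prime_average:
  fixes x :: real
  assumes b: "\<And>n. \<bar>b n\<bar> \<le> 1" and P: "finite P" "P \<noteq> {}" "\<And>p. p \<in> P \<Longrightarrow> prime p" and x: "x > 0"
  defines "H \<equiv> \<Sum>p\<in>P. 1 / real p"
  shows "\<bar>mean b x - (\<Sum>p\<in>P. mean (\<lambda>n. b (p * n)) (x / real p) / real p) / H\<bar>
      \<le> sqrt (1 / H + 2 * real (card P) / (H * x))"
proof -
  let ?N = "{1..nat \<lfloor>x\<rfloor>}"
  define w where "w n = H - real (card {p\<in>P. p dvd n})" for n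
  have pos: "p > 0" if "p \<in> P" for p using P that prime_gt_0_nat by blast
  have H: "H > 0" unfolding H_def using P pos by (intro sum_pos) auto
  have "(\<Sum>p\<in>P. mean (\<lambda>n. b (p * n)) (x / real p) / real p)
      = (\<Sum>n\<in>?N. \<Sum>p\<in>P. if p dvd n then b n else 0) / x"
    using x pos by (subst sum.swap) (simp add: mean_multiples sum_divide_distrib)
  also have "\<dots> = (\<Sum>n\<in>?N. b n * (H - w n)) / x"
    using P(1) by (simp add: w_def sum.If_cases Int_def mult.commute)
  finally have "mean b x - (\<Sum>p\<in>P. mean (\<lambda>n. b (p * n)) (x / real p) / real p) / H
      = (\<Sum>n\<in>?N. b n * w n) / (x * H)"
    using x H by (simp add: mean_def field_simps sum_distrib_left sum_subtractf)
  moreover have "\<bar>\<Sum>n\<in>?N. b n * w n\<bar> \<le> sqrt (x * (H * x + 2 * H * real (card P)))"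
  proof -
    have "(\<Sum>n\<in>?N. b n * w n)\<^sup>2 \<le> (\<Sum>n\<in>?N. (b n)\<^sup>2) * (\<Sum>n\<in>?N. (w n)\<^sup>2)"
      by (rule Cauchy_Schwarz_ineq_sum)
    also have "\<dots> \<le> x * (H * x + 2 * H * real (card P))"
    proof (rule mult_mono)
      have "(\<Sum>n\<in>?N. (b n)\<^sup>2) \<le> (\<Sum>n\<in>?N. 1)"
        using b by (intro sum_mono) (simp add: abs_square_le_1)
      also have "\<dots> \<le> x" using x by simp
      finally show "(\<Sum>n\<in>?N. (b n)\<^sup>2) \<le> x" .
      show "(\<Sum>n\<in>?N. (w n)\<^sup>2) \<le> H * x + 2 * H * real (card P)"
        unfolding w_def H_def using P x by (intro turan_kubilius) auto
    qed (use x in \<open>auto intro: sum_nonneg\<close>)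
    finally show ?thesis by (metis real_sqrt_abs real_sqrt_le_iff)
  qed
  ultimately have "\<bar>mean b x - (\<Sum>p\<in>P. mean (\<lambda>n. b (p * n)) (x / real p) / real p) / H\<bar>
      \<le> sqrt (x * (H * x + 2 * H * real (card P))) / (x * H)"
    using x H by (simp add: abs_divide divide_right_mono)
  also have "x * H = sqrt ((x * H)\<^sup>2)" using x H by simp
  also have "sqrt (x * (H * x + 2 * H * real (card P))) / sqrt ((x * H)\<^sup>2)
      = sqrt (1 / H + 2 * real (card P) / (H * x))"
    unfolding real_sqrt_divide[symmetric] using x H by (simp add: field_simps power2_eq_square)
  finally show ?thesis .
qed

lemma num_prime_factors_prime_mult:
  assumes "prime p" "n > 0"
  shows "num_prime_factors (p * n) = Suc (num_prime_factors n)"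
  using assms by (simp add: num_prime_factors_def prime_factorization_mult prime_factorization_prime)

text \<open>If the means stayed \<open>\<eta>\<close> apart along some filter, all means at
  \<open>N * exp t\<close> would converge along a finer one to a \<open>prime_harmonic\<close>
  function that depends on \<open>j\<close>, against \<open>prime_harmonic_const\<close>.\<close>

lemma mean_shift_num_prime_factors:
  assumes a: "\<And>k. \<bar>a k\<bar> \<le> (1::real)"
  shows "(\<lambda>N. mean (\<lambda>n. a (num_prime_factors n)) (real N) - mean (\<lambda>n. a (Suc (num_prime_factors n))) (real N)) \<longlonglongrightarrow> 0"
proof (rule ccontr)
  let ?b = "\<lambda>j n. a (num_prime_factors n + j)"
  let ?D = "\<lambda>N. mean (?b 0) (real N) - mean (?b 1) (real N)"
  assume "\<not> ?thesis"
  then have "\<not> ?D \<longlonglongrightarrow> 0" by simp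
  then obtain \<eta> where \<eta>: "\<eta> > 0" and not_ev: "\<not> eventually (\<lambda>N. \<bar>?D N\<bar> < \<eta>) sequentially"
    by (auto simp: tendsto_iff dist_real_def)
  define F where "F = inf sequentially (principal {N. \<bar>?D N\<bar> \<ge> \<eta>})"
  have F: "F \<noteq> bot"
    using not_ev unfolding F_def by (simp add: trivial_limit_def eventually_inf_principal not_le)
  \<comment> \<open>\<open>max N 1\<close> keeps the argument positive at \<open>N = 0\<close>;
    multiplication by \<open>exp t\<close> turns division by \<open>p\<close> into the translation
    \<open>t - ln p\<close>.\<close>
  define s where "s N i = mean (?b (fst i)) (real (max N 1) * exp (snd i))" for N and i :: "nat \<times> real"
  have s_le: "\<bar>s N i\<bar> \<le> 1" for N i
    unfolding s_def using a by (intro abs_mean_le) auto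
  obtain G S where G: "G \<noteq> bot" "G \<le> F" and lim: "\<And>i. ((\<lambda>N. s N i) \<longlongrightarrow> S i) G"
    using bounded_net_cluster[of F s, OF F s_le] by blast
  have top: "filterlim (\<lambda>N. real (max N 1)) at_top G"
  proof (rule filterlim_mono[OF _ order_refl])
    show "filterlim (\<lambda>N. real (max N 1)) at_top sequentially"
      by (rule filterlim_at_top_mono[OF filterlim_real_sequentially]) auto
    show "G \<le> sequentially" using G(2) unfolding F_def by (meson inf.boundedE)
  qed
  define S' where "S' j t = S (j, t)" for j t
  have lim': "((\<lambda>N. s N (j, t)) \<longlongrightarrow> S' j t) G" for j t unfolding S'_def by (rule lim)
  have "prime_harmonic S'"
    unfolding prime_harmonic_def
  proof (intro conjI allI impI)
    show "\<bar>S' j t\<bar> \<le> 1" for j t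
      by (rule tendsto_upperbound[OF tendsto_rabs[OF lim'] always_eventually G(1)]) (simp add: s_le)
    have lip: "\<bar>S' j t - S' j t'\<bar> \<le> 2 * (t' - t)" if "t \<le> t'" for j t t'
    proof (rule tendsto_le[OF G(1) _ tendsto_rabs[OF tendsto_diff[OF lim' lim']]])
      show "((\<lambda>N. 2 * (t' - t) + 1 / (real (max N 1) * exp t')) \<longlongrightarrow> 2 * (t' - t)) G"
      proof -
        have "((\<lambda>N. 1 / (real (max N 1) * exp t')) \<longlongrightarrow> 0) G"
          by (intro tendsto_divide_0[OF tendsto_const] filterlim_at_top_imp_at_infinity
                filterlim_at_top_mult_tendsto_pos[OF tendsto_const _ top]) auto
        from tendsto_add[OF tendsto_const this] show ?thesis by simp
      qed
      show "\<forall>\<^sub>F N in G. \<bar>s N (j, t) - s N (j, t')\<bar> \<le> 2 * (t' - t) + 1 / (real (max N 1) * exp t')"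
      proof (rule always_eventually, rule allI)
        fix N
        have "\<bar>s N (j, t) - s N (j, t')\<bar> 
            \<le> 2 * (ln (real (max N 1) * exp t') - ln (real (max N 1) * exp t)) + 1 / (real (max N 1) * exp t')"
          unfolding s_def fst_conv snd_conv using a that by (intro mean_diff_le mult_left_mono) auto
        then show "\<bar>s N (j, t) - s N (j, t')\<bar> \<le> 2 * (t' - t) + 1 / (real (max N 1) * exp t')"
          by (simp add: ln_mult)
      qed
    qed
    show "\<bar>S' j t - S' j t'\<bar> \<le> 2 * \<bar>t - t'\<bar>" for j t t'
      using lip[of t t' j] lip[of t' t j] by (cases "t \<le> t'") (auto simp: abs_minus_commute)
  next
    fix j t and P :: "nat set"
    assume P: "finite P" "P \<noteq> {}" "\<forall>p\<in>P. prime p"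
    define H where "H = (\<Sum>p\<in>P. 1 / real p)"
    have pos: "p > 0" if "p \<in> P" for p using P that prime_gt_0_nat by blast
    have H: "H > 0" unfolding H_def using P pos by (intro sum_pos) auto
    let ?x = "\<lambda>N. real (max N 1) * exp t"
    have "\<bar>S' j t - (\<Sum>p\<in>P. S' (Suc j) (t - ln (real p)) / real p) / H\<bar> \<le> sqrt (1 / H)"
    proof (rule tendsto_le[OF G(1)])
      show "((\<lambda>N. \<bar>s N (j, t) - (\<Sum>p\<in>P. s N (Suc j, t - ln (real p)) / real p) / H\<bar>)
          \<longlongrightarrow> \<bar>S' j t - (\<Sum>p\<in>P. S' (Suc j) (t - ln (real p)) / real p) / H\<bar>) G"
        using H pos by (intro tendsto_intros lim') auto
      \<comment> \<open>For fixed \<open>P\<close> the second error term of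
        \<open>mean_prime_average\<close> vanishes as \<open>N\<close> grows, which leaves the
        \<open>1 / sqrt H\<close> of the averaging clause.\<close>
      have "filterlim (\<lambda>N. H * ?x N) at_top G"
        using H by (intro filterlim_tendsto_pos_mult_at_top[OF tendsto_const]
            filterlim_at_top_mult_tendsto_pos[OF tendsto_const _ top]) auto
      then have "((\<lambda>N. 2 * real (card P) / (H * ?x N)) \<longlongrightarrow> 0) G"
        by (intro tendsto_divide_0[OF tendsto_const] filterlim_at_top_imp_at_infinity)
      from tendsto_real_sqrt[OF tendsto_add[OF tendsto_const this]]
      show "((\<lambda>N. sqrt (1 / H + 2 * real (card P) / (H * ?x N))) \<longlongrightarrow> sqrt (1 / H)) G" by simp
      show "\<forall>\<^sub>F N in G. \<bar>s N (j, t) - (\<Sum>p\<in>P. s N (Suc j, t - ln (real p)) / real p) / H\<bar>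
          \<le> sqrt (1 / H + 2 * real (card P) / (H * ?x N))"
      proof (rule always_eventually, rule allI)
        fix N
        \<comment> \<open>Multiplication by \<open>p\<close> raises the number of prime factors by
          one; this is how level \<open>Suc j\<close> enters.\<close>
        have "s N (Suc j, t - ln (real p)) = mean (\<lambda>n. ?b j (p * n)) (?x N / real p)" if "p \<in> P" for p
          using that P pos unfolding s_def mean_def
          by (auto simp: exp_diff num_prime_factors_prime_mult intro!: sum.cong arg_cong2[of _ _ _ _ "(/)"])
        then have "(\<Sum>p\<in>P. s N (Suc j, t - ln (real p)) / real p) 
            = (\<Sum>p\<in>P. mean (\<lambda>n. ?b j (p * n)) (?x N / real p) / real p)" by simp
        then show "\<bar>s N (j, t) - (\<Sum>p\<in>P. s N (Suc j, t - ln (real p)) / real p) / H\<bar>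
          \<le> sqrt (1 / H + 2 * real (card P) / (H * ?x N))"
          using mean_prime_average[of "?b j" P "?x N"] a P unfolding H_def s_def by simp
      qed
    qed
    then show "\<bar>S' j t - (\<Sum>p\<in>P. S' (Suc j) (t - ln (real p)) / real p) / (\<Sum>p\<in>P. 1 / real p)\<bar>
          \<le> 1 / sqrt (\<Sum>p\<in>P. 1 / real p)"
      unfolding H_def by (simp add: real_sqrt_divide)
  qed
  then have "S' 1 0 = S' 0 0" using prime_harmonic_const[of S' 0 0] by simp
  moreover have "((\<lambda>N. \<bar>s N (0, 0) - s N (1, 0)\<bar>) \<longlongrightarrow> \<bar>S' 0 0 - S' 1 0\<bar>) G"
    by (intro tendsto_intros lim')
  moreover have "\<forall>\<^sub>F N in G. \<eta> \<le> \<bar>s N (0, 0) - s N (1, 0)\<bar>"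
  proof -
    have "\<forall>\<^sub>F N in F. N \<ge> 1 \<and> \<bar>?D N\<bar> \<ge> \<eta>"
      unfolding F_def eventually_inf_principal using eventually_ge_at_top[of 1] by eventually_elim auto
    then have "\<forall>\<^sub>F N in G. N \<ge> 1 \<and> \<bar>?D N\<bar> \<ge> \<eta>" using G(2) by (rule filter_leD[rotated])
    then show ?thesis by eventually_elim (auto simp: s_def max_def)
  qed
  ultimately have "\<eta> \<le> \<bar>S' 0 0 - S' 1 0\<bar>"
    using G(1) by (metis tendsto_lowerbound)
  with \<open>S' 1 0 = S' 0 0\<close> \<eta> show False by simp
qed

section \<open>Regularization of finitely additive probabilities\<close>

locale finitely_additive_prob =
  fixes m :: "'a::metric_space set \<Rightarrow> real"
  assumes nonneg: "0 \<le> m A" and total: "m UNIV = 1"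
    and additive: "A \<inter> B = {} \<Longrightarrow> m (A \<union> B) = m A + m B"
begin

lemma content_mono: "A \<subseteq> B \<Longrightarrow> m A \<le> m B"
  using additive[of A "B - A"] nonneg[of "B - A"] by (simp add: Un_absorb1)

lemma content_empty: "m {} = 0"
  using additive[of "{}" "{}"] by simp

lemma content_subadditive: "m (A \<union> B) \<le> m A + m B"
  using additive[of A "B - A"] content_mono[of "B - A" B] by simp

text \<open>The classical passage from a content on compact sets to a Borel measure: an inner
  content on open sets, then an outer measure on all sets, then Caratheodory's theorem.\<close>

definition inner_content :: "'a set \<Rightarrow> ennreal" where
  "inner_content U = (SUP K\<in>{K. compact K \<and> K \<subseteq> U}. ennreal (m K))"

definition outer_content :: "'a set \<Rightarrow> ennreal" where
  "outer_content A = (INF U\<in>{U. open U \<and> A \<subseteq> U}. inner_content U)"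

lemma inner_upper: "compact K \<Longrightarrow> K \<subseteq> U \<Longrightarrow> ennreal (m K) \<le> inner_content U"
  unfolding inner_content_def by (rule SUP_upper) simp

lemma inner_mono: "U \<subseteq> V \<Longrightarrow> inner_content U \<le> inner_content V"
  unfolding inner_content_def by (rule SUP_subset_mono) auto

lemma outer_le_inner: "open U \<Longrightarrow> A \<subseteq> U \<Longrightarrow> outer_content A \<le> inner_content U"
  unfolding outer_content_def by (rule INF_lower) simp

lemma outer_open: "open U \<Longrightarrow> outer_content U = inner_content U"
  unfolding outer_content_def by (intro antisym INF_lower INF_greatest) (auto intro: inner_mono)

lemma outer_mono: "A \<subseteq> B \<Longrightarrow> outer_content A \<le> outer_content B"
  unfolding outer_content_def by (rule INF_superset_mono) auto

lemma outer_compact: "compact K \<Longrightarrow> ennreal (m K) \<le> outer_content K"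
  unfolding outer_content_def by (intro INF_greatest inner_upper) auto

lemma outer_empty: "outer_content {} = 0"
  by (simp add: outer_open inner_content_def content_empty)

lemma outer_less_top: "outer_content A < top"
proof -
  have "outer_content A \<le> inner_content UNIV" by (rule outer_le_inner) auto
  also have "\<dots> \<le> 1" unfolding inner_content_def using content_mono[of _ UNIV] total by (intro SUP_least) auto
  finally show ?thesis by (simp add: order_le_less_trans)
qed

text \<open>Normality separates the disjoint closed sets \<open>K - W\<close> and
  \<open>K - U\<close> by open sets \<open>A\<close> and \<open>B\<close>; the pieces are
  \<open>K - B\<close> and \<open>K - A\<close>.\<close>

lemma compact_split:
  assumes "compact (K :: 'a set)" "open U" "open W" "K \<subseteq> U \<union> W"
  obtains K1 K2 where "compact K1" "compact K2" "K1 \<subseteq> U" "K2 \<subseteq> W" "K = K1 \<union> K2"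
proof -
  have "compact (K - W)" "compact (K - U)" using assms by (auto intro: compact_diff)
  then have "closed (K - W)" "closed (K - U)" by (auto intro: compact_imp_closed)
  moreover have "(K - W) \<inter> (K - U) = {}" using assms(4) by blast
  ultimately obtain A B where AB: "open A" "open B" "K - W \<subseteq> A" "K - U \<subseteq> B" "A \<inter> B = {}"
    using t4_space by metis
  show ?thesis
  proof
    show "compact (K - B)" "compact (K - A)" using assms AB by (auto intro: compact_diff)
  qed (use AB in auto)
qed

lemma compact_le_sum_inner:
  assumes "finite I" "compact K" "\<And>i. i \<in> I \<Longrightarrow> open (U i)" "K \<subseteq> (\<Union>i\<in>I. U i)"
  shows "ennreal (m K) \<le> (\<Sum>i\<in>I. inner_content (U i))"
  using assms
proof (induction I arbitrary: K rule: finite_induct)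
  case empty
  then show ?case by (simp add: content_empty)
next
  case (insert i I)
  then have "open (U i)" "open (\<Union>i\<in>I. U i)" "K \<subseteq> U i \<union> (\<Union>i\<in>I. U i)" by auto
  then obtain K1 K2 where K: "compact K1" "compact K2" "K1 \<subseteq> U i" "K2 \<subseteq> (\<Union>i\<in>I. U i)" "K = K1 \<union> K2"
    by (rule compact_split[OF insert.prems(1)])
  have "ennreal (m K) \<le> ennreal (m K1 + m K2)" using content_subadditive K by (auto intro: ennreal_leI)
  also have "\<dots> = ennreal (m K1) + ennreal (m K2)" using nonneg by (intro ennreal_plus)
  also have "\<dots> \<le> inner_content (U i) + (\<Sum>i\<in>I. inner_content (U i))"
    using K insert by (intro add_mono inner_upper insert.IH) auto
  finally show ?case using insert by simp
qed

text \<open>Compactness replaces the countable cover of \<open>K\<close> by a finite one, which is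
  how countable subadditivity arises from a merely finitely additive \<open>m\<close>.\<close>

lemma inner_countably_subadditive:
  assumes "\<And>n::nat. open (U n)"
  shows "inner_content (\<Union>n. U n) \<le> (\<Sum>n. inner_content (U n))"
  unfolding inner_content_def[of "\<Union>n. U n"]
proof (rule SUP_least)
  fix K assume "K \<in> {K. compact K \<and> K \<subseteq> (\<Union>n. U n)}"
  then have K: "compact K" "K \<subseteq> (\<Union>n. U n)" by auto
  then obtain I where I: "finite I" "K \<subseteq> (\<Union>i\<in>I. U i)"
    using assms by (elim compactE_image[of K UNIV U]) auto
  have "ennreal (m K) \<le> (\<Sum>i\<in>I. inner_content (U i))"
    using I K assms by (intro compact_le_sum_inner) auto
  also have "\<dots> \<le> (\<Sum>n. inner_content (U n))" using I by (intro sum_le_suminf) auto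
  finally show "ennreal (m K) \<le> (\<Sum>n. inner_content (U n))" .
qed

lemma outer_countably_subadditive: "outer_content (\<Union>n. A n) \<le> (\<Sum>n::nat. outer_content (A n))"
proof (rule ennreal_le_epsilon)
  fix e :: real assume e: "e > 0"
  have "\<exists>U. open U \<and> A n \<subseteq> U \<and> inner_content U < outer_content (A n) + e * (1/2) ^ Suc n" for n
  proof -
    have "outer_content (A n) < outer_content (A n) + e * (1/2) ^ Suc n" using e outer_less_top[of "A n"] by simp
    then show ?thesis unfolding outer_content_def[of "A n"] INF_less_iff by (auto simp: outer_content_def[symmetric])
  qed
  then obtain U where U: "\<And>n. open (U n)" "\<And>n. A n \<subseteq> U n" 
      "\<And>n. inner_content (U n) < outer_content (A n) + e * (1/2) ^ Suc n" by metis
  have "outer_content (\<Union>n. A n) \<le> inner_content (\<Union>n. U n)" using U by (intro outer_le_inner) auto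
  also have "\<dots> \<le> (\<Sum>n. inner_content (U n))" using U by (intro inner_countably_subadditive)
  also have "\<dots> \<le> (\<Sum>n. outer_content (A n) + e * (1/2) ^ Suc n)"
    using U by (intro suminf_le) (auto intro: less_imp_le)
  also have "\<dots> = (\<Sum>n. outer_content (A n)) + (\<Sum>n. ennreal e * ennreal ((1/2) ^ Suc n))"
    using \<open>0 < e\<close> by (subst suminf_add[symmetric])
                     (auto simp del: ennreal_suminf_cmult simp add: ennreal_mult[symmetric])
  also have "\<dots> = (\<Sum>n. outer_content (A n)) + e"
    unfolding ennreal_suminf_cmult
    by (subst suminf_ennreal_eq[OF zero_le_power power_half_series]) auto
  finally show "outer_content (\<Union>n. A n) \<le> (\<Sum>n. outer_content (A n)) + e" .
qed

text \<open>For compact \<open>K\<close> inside \<open>U \<inter> V\<close>, the open set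
  \<open>V - K\<close> contains \<open>V - U\<close>. A compact \<open>L\<close> in
  \<open>V - K\<close> is disjoint from \<open>K\<close>, so \<open>m\<close> is additive on
  \<open>K \<union> L\<close>, which lies in \<open>V\<close>; suprema over \<open>L\<close> and
  then over \<open>K\<close> give the claim.\<close>

lemma inner_split:
  assumes "open U" "open V"
  shows "inner_content (U \<inter> V) + outer_content (V - U) \<le> inner_content V"
proof -
  have "ennreal (m K) + outer_content (V - U) \<le> inner_content V" if K: "compact K" "K \<subseteq> U \<inter> V" for K
  proof -
    have "outer_content (V - U) \<le> inner_content (V - K)"
      using K assms by (intro outer_le_inner) (auto intro: open_Diff compact_imp_closed)
    then have "ennreal (m K) + outer_content (V - U) \<le> ennreal (m K) + inner_content (V - K)" by (rule add_left_mono)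
    also have "\<dots> = (SUP L\<in>{L. compact L \<and> L \<subseteq> V - K}. ennreal (m K) + ennreal (m L))"
      unfolding inner_content_def by (rule ennreal_SUP_add_right) auto
    also have "\<dots> \<le> inner_content V"
    proof (rule SUP_least)
      fix L assume "L \<in> {L. compact L \<and> L \<subseteq> V - K}"
      then have L: "compact L" "L \<subseteq> V - K" by auto
      have "ennreal (m K) + ennreal (m L) = ennreal (m (K \<union> L))"
        using nonneg L by (subst additive) (auto simp: ennreal_plus)
      also have "\<dots> \<le> inner_content V" using K L by (intro inner_upper) auto
      finally show "ennreal (m K) + ennreal (m L) \<le> inner_content V" .
    qed
    finally show ?thesis .
  qed
  then have "(SUP K\<in>{K. compact K \<and> K \<subseteq> U \<inter> V}. ennreal (m K) + outer_content (V - U)) \<le> inner_content V"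
    by (intro SUP_least) auto
  also have "(SUP K\<in>{K. compact K \<and> K \<subseteq> U \<inter> V}. ennreal (m K) + outer_content (V - U)) = inner_content (U \<inter> V) + outer_content (V - U)"
    unfolding inner_content_def by (rule ennreal_SUP_add_left) auto
  finally show ?thesis .
qed

lemma outer_measure_space_outer: "outer_measure_space UNIV outer_content"
  unfolding outer_measure_space_def positive_def increasing_def countably_subadditive_def
  using outer_empty outer_mono outer_countably_subadditive by auto

text \<open>Caratheodory measurability of open sets. The nontrivial inequality is tested on open
  supersets \<open>V\<close> of \<open>A\<close>, where it follows from \<open>inner_split\<close>;
  the other one is subadditivity.\<close>

lemma open_lambda_system:
  assumes "open U"
  shows "U \<in> lambda_system UNIV UNIV outer_content"
proof -
  have "outer_content (U \<inter> A) + outer_content ((UNIV - U) \<inter> A) = outer_content A" for A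
  proof (rule antisym)
    have "outer_content (U \<inter> A) + outer_content ((UNIV - U) \<inter> A) \<le> inner_content V" if "open V" "A \<subseteq> V" for V
    proof -
      have "outer_content (U \<inter> A) + outer_content ((UNIV - U) \<inter> A) \<le> inner_content (U \<inter> V) + outer_content (V - U)"
        using assms that by (intro add_mono outer_le_inner outer_mono) auto
      also have "\<dots> \<le> inner_content V" using assms that by (intro inner_split)
      finally show ?thesis .
    qed
    then show "outer_content (U \<inter> A) + outer_content ((UNIV - U) \<inter> A) \<le> outer_content A"
      unfolding outer_content_def[of A] by (intro INF_greatest) auto
  next
    let ?B = "\<lambda>n::nat. if n = 0 then U \<inter> A else if n = 1 then (UNIV - U) \<inter> A else {}"
    have "outer_content A = outer_content (\<Union>n. ?B n)" by (rule arg_cong[of _ _ outer_content]) (auto split: if_splits)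
    also have "\<dots> \<le> (\<Sum>n. outer_content (?B n))" by (rule outer_countably_subadditive)
    also have "\<dots> = (\<Sum>n\<in>{0,1}. outer_content (?B n))"
      by (rule suminf_finite) (auto simp: outer_empty)
    also have "\<dots> = outer_content (U \<inter> A) + outer_content ((UNIV - U) \<inter> A)" by simp
    finally show "outer_content A \<le> outer_content (U \<inter> A) + outer_content ((UNIV - U) \<inter> A)" .
  qed
  then show ?thesis by (simp add: lambda_system_def)
qed

definition regularization :: "'a measure" where
  "regularization = measure_of UNIV (sets borel) outer_content"

lemma sets_regularization: "sets regularization = sets borel"
  unfolding regularization_def using sets.sigma_sets_eq[of "borel :: 'a measure"] 
  by (simp add: sets_measure_of_conv)

lemma emeasure_regularization:
  assumes "A \<in> sets borel"
  shows "emeasure regularization A = outer_content A"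
proof -
  let ?L = "lambda_system UNIV UNIV outer_content"
  interpret U: sigma_algebra "UNIV :: 'a set" UNIV using sigma_algebra_Pow[of "UNIV :: 'a set"] by simp
  have ms: "measure_space UNIV ?L outer_content"
    by (rule U.caratheodory_lemma[OF outer_measure_space_outer])
  then have "sigma_algebra UNIV ?L" by (simp add: measure_space_def)
  then have "sigma_sets UNIV {U. open U} \<subseteq> ?L"
    using open_lambda_system by (intro sigma_algebra.sigma_sets_subset) auto
  then have sub: "sets borel \<subseteq> ?L" by (simp add: sets_borel)
  have "countably_additive (sets borel) outer_content"
    using ms sub unfolding measure_space_def countably_additive_def by blast
  moreover have "positive (sets borel) outer_content" by (simp add: positive_def outer_empty)
  moreover have "sigma_algebra UNIV (sets (borel :: 'a measure))"
    using sets.sigma_algebra_axioms[of "borel :: 'a measure"] by simp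
  ultimately show ?thesis unfolding regularization_def using assms
    by (intro emeasure_measure_of_sigma)
qed

lemma prob_space_regularization:
  assumes "compact X" "m X = 1"
  shows "prob_space regularization"
proof
  have "inner_content UNIV \<le> 1" unfolding inner_content_def using content_mono[of _ UNIV] total by (intro SUP_least) auto
  moreover have "1 \<le> inner_content UNIV" using inner_upper[of X UNIV] assms by simp
  ultimately have "inner_content UNIV = 1" by (rule antisym)
  moreover have "space regularization = UNIV"
    using sets_eq_imp_space_eq[OF sets_regularization] by simp
  ultimately show "emeasure regularization (space regularization) = 1"
    by (simp add: emeasure_regularization outer_open)
qed

end

text \<open>The regularization gives \<open>X\<close> full measure because \<open>1 = m X\<close>
  bounds it from below, so it may be restricted to \<open>X\<close>. The last two properties are all
  that is used later: compact sets can only gain mass, and the mass of open sets is approximated by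
  \<open>m\<close> from inside.\<close>

lemma finitely_additive_regularization:
  fixes m :: "'a::metric_space set \<Rightarrow> real"
  assumes m: "finitely_additive_prob m" and X: "compact X" "m X = 1"
  obtains \<nu> where "sets \<nu> = sets (restrict_space borel X)" "prob_space \<nu>"
    "\<And>K. compact K \<Longrightarrow> K \<subseteq> X \<Longrightarrow> m K \<le> measure \<nu> K"
    "\<And>U e. open U \<Longrightarrow> e < measure \<nu> (U \<inter> X) \<Longrightarrow> \<exists>K. compact K \<and> K \<subseteq> U \<inter> X \<and> e < m K"
proof -
  interpret finitely_additive_prob m by (rule m)
  interpret P: prob_space regularization using X by (rule prob_space_regularization)
  have sp: "space regularization = UNIV"
    using sets_eq_imp_space_eq[OF sets_regularization] by simp
  have Xs: "X \<in> sets borel" using X by (simp add: compact_imp_closed)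
  have ge: "m K \<le> measure regularization K" if "compact K" for K
  proof -
    have "ennreal (m K) \<le> emeasure regularization K"
      using that outer_compact[of K] by (simp add: emeasure_regularization compact_imp_closed)
    then show ?thesis by (simp add: P.emeasure_eq_measure)
  qed
  have PX: "measure regularization X = 1" using ge[of X] X P.prob_le_1[of X] by simp
  have mX: "m (- X) = 0" using additive[of X "- X"] total X by simp
  have UX: "measure regularization (U \<inter> X) = measure regularization U" if "U \<in> sets borel" for U
  proof -
    have "AE x in regularization. x \<in> X"
      using PX Xs by (subst P.AE_in_set_eq_1) (auto simp: sets_regularization)
    then show ?thesis using that Xs
      by (intro P.finite_measure_eq_AE) (auto simp: sets_regularization)
  qed
  have meas: "measure (restrict_space regularization X) A = measure regularization A" if "A \<subseteq> X" for A
    using that Xs by (intro measure_restrict_space) (auto simp: sp sets_regularization)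
  show ?thesis
  proof
    show "sets (restrict_space regularization X) = sets (restrict_space borel X)"
      by (rule sets_restrict_space_cong[OF sets_regularization])
    show "prob_space (restrict_space regularization X)"
      using PX Xs by (intro prob_space_restrict_space) (auto simp: P.emeasure_eq_measure sets_regularization)
    show "m K \<le> measure (restrict_space regularization X) K" if "compact K" "K \<subseteq> X" for K
      using ge that meas by simp
    show "\<exists>K. compact K \<and> K \<subseteq> U \<inter> X \<and> e < m K"
      if U: "open U" "e < measure (restrict_space regularization X) (U \<inter> X)" for U e
    \<comment> \<open>\<open>ennreal\<close> truncates negative numbers to 0, so negative
      \<open>e\<close> is treated apart, with the empty set as witness.\<close>
    proof (cases "e < 0")
      case True
      then show ?thesis by (intro exI[of _ "{}"]) (auto simp: content_empty)
    next
      case False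
      have "ennreal e < emeasure regularization U"
        using U False meas UX[of U] by (simp add: P.emeasure_eq_measure ennreal_less_iff)
      also have "\<dots> = inner_content U" using U by (simp add: emeasure_regularization outer_open)
      finally obtain K where K: "compact K" "K \<subseteq> U" "e < m K"
        unfolding inner_content_def less_SUP_iff using False by (auto simp: ennreal_less_iff)
      have "m K \<le> m (K \<inter> X) + m (- X)"
        using content_mono[of K "(K \<inter> X) \<union> - X"] content_subadditive[of "K \<inter> X" "- X"] by fastforce
      then show ?thesis using K X mX by (intro exI[of _ "K \<inter> X"]) (auto intro: compact_Int)
    qed
  qed
qed

text \<open>Complements reverse the inequality on closed sets, while shrinking open neighborhoods of
  a closed set preserve it in the limit. So the measures agree on closed sets, which are stable
  under intersection and generate the Borel sets.\<close>

lemma measure_eqI_open_le: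
  fixes M N :: "'a::metric_space measure"
  assumes M: "sets M = sets borel" "prob_space M" and N: "sets N = sets borel" "prob_space N"
    and le: "\<And>U. open U \<Longrightarrow> measure M U \<le> measure N U"
  shows "M = N"
proof -
  interpret M: prob_space M by fact
  interpret N: prob_space N by fact
  have sp: "space M = UNIV" "space N = UNIV"
    using sets_eq_imp_space_eq[OF M(1)] sets_eq_imp_space_eq[OF N(1)] by auto
  have closed_eq: "measure M F = measure N F" if F: "closed F" for F
  proof (rule antisym)
    have "measure M (- F) \<le> measure N (- F)" using F by (intro le) auto
    moreover have "- F = space M - F" "- F = space N - F" by (auto simp: sp)
    ultimately show "measure N F \<le> measure M F"
      using M.prob_compl[of F] N.prob_compl[of F] F by (simp add: M(1) N(1))
    show "measure M F \<le> measure N F"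
    \<comment> \<open>\<open>infdist\<close> to the empty set is 0 by convention, so the
      neighborhoods \<open>U n\<close> would be the whole space there.\<close>
    proof (cases "F = {}")
      case False
      define U where "U n = {x. infdist x F < 1 / real (Suc n)}" for n
      have U: "open (U n)" for n
        unfolding U_def by (intro open_Collect_less continuous_intros)
      then have rU: "range U \<subseteq> sets borel" by auto
      have "decseq U" unfolding U_def decseq_def
        by (auto elim!: less_le_trans intro!: divide_left_mono)
      have "(\<Inter>n. U n) = F"
      proof (intro equalityI subsetI)
        fix x assume "x \<in> (\<Inter>n. U n)"
        then have "infdist x F < 1 / real (Suc n)" for n by (auto simp: U_def)
        then have "infdist x F \<le> 0"
          by (intro LIMSEQ_le_const[OF LIMSEQ_inverse_real_of_nat])
             (auto intro!: exI[of _ 0] less_imp_le simp: inverse_eq_divide)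
        then show "x \<in> F" using False F by (metis antisym infdist_nonneg in_closed_iff_infdist_zero)
      qed (auto simp: U_def)
      then have lims: "(\<lambda>n. measure M (U n)) \<longlonglongrightarrow> measure M F" "(\<lambda>n. measure N (U n)) \<longlonglongrightarrow> measure N F"
        using M.finite_Lim_measure_decseq[of U] N.finite_Lim_measure_decseq[of U] rU \<open>decseq U\<close>
        by (auto simp: M(1) N(1))
      show ?thesis by (rule LIMSEQ_le[OF lims]) (use le U in auto)
    qed simp
  qed
  have "Int_stable (Collect (closed :: 'a set \<Rightarrow> bool))" by (auto simp: Int_stable_def)
  moreover have "sets (borel :: 'a measure) = sigma_sets UNIV (Collect closed)"
    by (simp add: borel_eq_closed)
  ultimately show ?thesis
    by (intro measure_eqI_generator_eq[where E = "Collect closed" and \<Omega> = UNIV and A = "\<lambda>_. UNIV"])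
       (simp_all add: M(1) N(1) M.emeasure_eq_measure N.emeasure_eq_measure closed_eq)
qed

section \<open>Convergence of orbit averages\<close>

lemma integrable_continuous_on_compact:
  fixes f :: "'a::metric_space \<Rightarrow> 'b::{banach, second_countable_topology}"
  assumes "compact X" "continuous_on X f" and \<nu>: "sets \<nu> = sets (restrict_space borel X)" "prob_space \<nu>"
  shows "integrable \<nu> f"
proof -
  interpret prob_space \<nu> by fact
  have sp: "space \<nu> = X" using sets_eq_imp_space_eq[OF \<nu>(1)] by (simp add: space_restrict_space)
  obtain B where B: "\<And>x. x \<in> X \<Longrightarrow> norm (f x) \<le> B"
    using compact_imp_bounded[OF compact_continuous_image[OF assms(2,1)]] by (auto simp: bounded_iff)
  have "f \<in> borel_measurable (restrict_space borel X)"
    using assms(2) by (rule borel_measurable_continuous_on_restrict)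
  then have "f \<in> borel_measurable \<nu>" using measurable_cong_sets[OF \<nu>(1) refl] by blast
  then show ?thesis using B sp by (intro integrable_const_bound[of _ B]) auto
qed

section \<open>Empirical averages and their limit measures\<close>

definition frequency :: "(nat \<Rightarrow> 'a) \<Rightarrow> nat \<Rightarrow> 'a set \<Rightarrow> real" where
  "frequency z N A = (\<Sum>n=1..N. indicator A (z n)) / real N"

text \<open>\<open>L\<close> is the integer part of \<open>k * y\<close>. This is a discrete
  layer-cake formula, which reduces averages of \<open>f\<close> to frequencies of the level
  sets.\<close>

lemma sum_levels:
  fixes y :: real and k :: nat
  assumes "0 \<le> y" "y \<le> 1"
  defines "L \<equiv> (\<Sum>i=1..k. if real i \<le> real k * y then 1 else 0 :: real)"
  shows "L \<le> real k * y" "real k * y \<le> 1 + L"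
proof -
  have "real k * y \<le> real k * 1" using assms by (intro mult_left_mono) auto
  then have "{1..k} \<inter> {i. real i \<le> real k * y} = {1..nat \<lfloor>real k * y\<rfloor>}"
    using assms by (auto simp: le_nat_iff le_floor_iff)
  then have "L = real (nat \<lfloor>real k * y\<rfloor>)" unfolding L_def by (simp add: sum.If_cases)
  moreover have "real k * y \<ge> 0" using assms by simp
  ultimately show "L \<le> real k * y" "real k * y \<le> 1 + L" by linarith+
qed

lemma integral_ge_levels:
  fixes f :: "'a::metric_space \<Rightarrow> real"
  assumes "compact X" "continuous_on X f" "\<And>x. x \<in> X \<Longrightarrow> 0 \<le> f x \<and> f x \<le> 1"
    and \<nu>: "sets \<nu> = sets (restrict_space borel X)" "prob_space \<nu>"
  shows "(\<Sum>i=1..k. measure \<nu> {x\<in>X. real i \<le> real k * f x}) \<le> real k * (\<integral>x. f x \<partial>\<nu>)"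
proof -
  interpret prob_space \<nu> by fact
  have sp: "space \<nu> = X" using sets_eq_imp_space_eq[OF \<nu>(1)] by (simp add: space_restrict_space)
  have int: "integrable \<nu> f" using assms by (intro integrable_continuous_on_compact)
  then have [measurable]: "f \<in> borel_measurable \<nu>" by simp
  have K: "{x\<in>X. real i \<le> real k * f x} \<in> sets \<nu>" for i
    unfolding sp[symmetric] by measurable
  have "(\<Sum>i=1..k. measure \<nu> {x\<in>X. real i \<le> real k * f x})
      = (\<integral>x. (\<Sum>i=1..k. indicator {x\<in>X. real i \<le> real k * f x} x) \<partial>\<nu>)"
    using K by (subst Bochner_Integration.integral_sum) (auto simp: emeasure_eq_measure)
  also have "\<dots> \<le> (\<integral>x. real k * f x \<partial>\<nu>)"
  proof (rule integral_mono)
    show "integrable \<nu> (\<lambda>x. \<Sum>i=1..k. indicator {x\<in>X. real i \<le> real k * f x} x :: real)"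
      using K by (intro Bochner_Integration.integrable_sum) (auto simp: emeasure_eq_measure)
    fix x assume "x \<in> space \<nu>"
    then show "(\<Sum>i=1..k. indicator {x\<in>X. real i \<le> real k * f x} x) \<le> real k * f x"
      using sum_levels(1)[of "f x" k] assms(3)[of x] by (simp add: sp indicator_def of_bool_def)
  qed (use int in auto)
  finally show ?thesis by simp
qed

lemma average_le_levels:
  fixes f :: "'a \<Rightarrow> real"
  assumes "\<And>n. z n \<in> X" "\<And>x. x \<in> X \<Longrightarrow> 0 \<le> f x \<and> f x \<le> 1" "k > 0"
  shows "(\<Sum>n=1..N. f (z n)) / real N
      \<le> (1 + (\<Sum>i=1..k. frequency z N {x\<in>X. real i \<le> real k * f x})) / real k"
proof (cases "N = 0")
  case False
  have "real k * (\<Sum>n=1..N. f (z n)) \<le> (\<Sum>n=1..N. 1 + (\<Sum>i=1..k. indicator {x\<in>X. real i \<le> real k * f x} (z n)))"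
    unfolding sum_distrib_left
  proof (rule sum_mono)
    fix n show "real k * f (z n) \<le> 1 + (\<Sum>i=1..k. indicator {x\<in>X. real i \<le> real k * f x} (z n))"
      using sum_levels(2)[of "f (z n)" k] assms by (simp add: indicator_def of_bool_def)
  qed
  also have "\<dots> = real N * (1 + (\<Sum>i=1..k. frequency z N {x\<in>X. real i \<le> real k * f x}))"
    using False unfolding frequency_def sum_divide_distrib[symmetric]
    by (subst sum.swap) (simp add: sum.distrib field_simps sum.swap[of _ "{1..N}"])
  finally show ?thesis using False assms(3) by (simp add: field_simps)
qed (simp add: frequency_def)

text \<open>Level sets \<open>k * f \<ge> i\<close> are compact, and \<open>m\<close> is at most
  \<open>\<nu>\<close> on them. The layer-cake sums therefore bound the limiting averages of
  \<open>f\<close> by its integral, up to \<open>1 / k\<close>; the same bound for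
  \<open>1 - f\<close> gives convergence.\<close>

lemma empirical_cluster:
  fixes z :: "nat \<Rightarrow> 'a::metric_space"
  assumes X: "compact X" and z: "\<And>n. z n \<in> X" and F: "F \<noteq> bot" "F \<le> sequentially"
  obtains G m \<nu> where "G \<noteq> bot" "G \<le> F" "\<And>A. ((\<lambda>N. frequency z N A) \<longlongrightarrow> m A) G"
    "sets \<nu> = sets (restrict_space borel X)" "prob_space \<nu>"
    "\<And>K. compact K \<Longrightarrow> K \<subseteq> X \<Longrightarrow> m K \<le> measure \<nu> K"
    "\<And>U e. open U \<Longrightarrow> e < measure \<nu> (U \<inter> X) \<Longrightarrow> \<exists>K. compact K \<and> K \<subseteq> U \<inter> X \<and> e < m K"
    "\<forall>f. continuous_on X f \<longrightarrow> (\<forall>x\<in>X. 0 \<le> f x \<and> f x \<le> (1::real)) \<longrightarrow>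
       ((\<lambda>N. (\<Sum>n=1..N. f (z n)) / real N) \<longlongrightarrow> (\<integral>x. f x \<partial>\<nu>)) G"
proof -
  have freq: "0 \<le> frequency z N A" "frequency z N A \<le> 1" for N A
  proof -
    show "0 \<le> frequency z N A" unfolding frequency_def by (intro divide_nonneg_nonneg sum_nonneg) auto
    have "(\<Sum>n=1..N. indicator A (z n)) \<le> (\<Sum>n=1..N. 1::real)" by (intro sum_mono) (auto simp: indicator_def)
    then show "frequency z N A \<le> 1" unfolding frequency_def by (cases "N = 0") (auto simp: divide_le_eq_1)
  qed
  then have freq_abs: "\<bar>frequency z N A\<bar> \<le> 1" for N A by (simp add: abs_le_iff minus_le_iff add_increasing2) 
  obtain G m where G: "G \<noteq> bot" "G \<le> F" and lim: "\<And>A. ((\<lambda>N. frequency z N A) \<longlongrightarrow> m A) G"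
    using bounded_net_cluster[of F "frequency z", OF F(1) freq_abs] by blast
  \<comment> \<open>At \<open>N = 0\<close> division by zero makes every frequency 0, so total mass
    1 is only available from \<open>N = 1\<close> on.\<close>
  have ev: "\<forall>\<^sub>F N in G. N \<ge> 1"
    using G(2) F(2) eventually_ge_at_top[of "1::nat"] by (metis filter_leD order_trans)
  have one: "m A = 1" if "X \<subseteq> A" for A
  proof -
    have "\<forall>\<^sub>F N in G. frequency z N A = 1"
      using ev by eventually_elim (use z that in \<open>auto simp: frequency_def indicator_def subset_eq\<close>)
    then have "((\<lambda>N. frequency z N A) \<longlongrightarrow> 1) G" by (rule tendsto_eventually)
    with lim show ?thesis using G(1) by (metis tendsto_unique)
  qed
  have "finitely_additive_prob m"
  proof
    show "0 \<le> m A" for A by (rule tendsto_lowerbound[OF lim always_eventually G(1)]) (simp add: freq)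
    show "m UNIV = 1" by (rule one) simp
    show "m (A \<union> B) = m A + m B" if "A \<inter> B = {}" for A B
    proof -
      have "frequency z N (A \<union> B) = frequency z N A + frequency z N B" for N
        using that by (simp add: frequency_def indicator_add[symmetric] sum.distrib add_divide_distrib)
      then have "((\<lambda>N. frequency z N (A \<union> B)) \<longlongrightarrow> m A + m B) G"
        by (simp add: tendsto_add lim)
      with lim show ?thesis using G(1) by (metis tendsto_unique)
    qed
  qed
  then obtain \<nu> where \<nu>: "sets \<nu> = sets (restrict_space borel X)" "prob_space \<nu>"
    and ge: "\<And>K. compact K \<Longrightarrow> K \<subseteq> X \<Longrightarrow> m K \<le> measure \<nu> K"
    and op: "\<And>U e. open U \<Longrightarrow> e < measure \<nu> (U \<inter> X) \<Longrightarrow> \<exists>K. compact K \<and> K \<subseteq> U \<inter> X \<and> e < m K"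
    using finitely_additive_regularization[of m X] X one[of X] by blast
  interpret prob_space \<nu> by fact
  have upper: "\<forall>\<^sub>F N in G. (\<Sum>n=1..N. f (z n)) / real N < (\<integral>x. f x \<partial>\<nu>) + e"
    if f: "continuous_on X f" "\<And>x. x \<in> X \<Longrightarrow> 0 \<le> f x \<and> f x \<le> (1::real)" and "e > 0" for f e
  proof -
    obtain k :: nat where k: "k > 0" "1 / real k < e"
      using \<open>e > 0\<close> by (metis nat_approx_posE zero_less_Suc)
    let ?K = "\<lambda>i. {x\<in>X. real i \<le> real k * f x}"
    have "compact (?K i)" for i
    proof -
      have "closed (X \<inter> (\<lambda>x. real k * f x) -` {real i..})"
        using X f by (intro continuous_closed_preimage continuous_intros) (auto intro: compact_imp_closed)
      moreover have "X \<inter> (\<lambda>x. real k * f x) -` {real i..} = X \<inter> ?K i" by auto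
      ultimately show ?thesis using compact_Int_closed[OF X, of "X \<inter> ?K i"] by (simp add: Int_absorb1 subset_eq)
    qed
    then have "(\<Sum>i=1..k. m (?K i)) \<le> (\<Sum>i=1..k. measure \<nu> (?K i))" by (intro sum_mono ge) auto
    also have "\<dots> \<le> real k * (\<integral>x. f x \<partial>\<nu>)" using X f \<nu> by (intro integral_ge_levels)
    finally have "(1 + (\<Sum>i=1..k. m (?K i))) / real k < (\<integral>x. f x \<partial>\<nu>) + e"
      using k by (simp add: field_simps)
    moreover have "((\<lambda>N. (1 + (\<Sum>i=1..k. frequency z N (?K i))) / real k) \<longlongrightarrow> (1 + (\<Sum>i=1..k. m (?K i))) / real k) G"
      using k by (intro tendsto_intros lim) auto
    ultimately have "\<forall>\<^sub>F N in G. (1 + (\<Sum>i=1..k. frequency z N (?K i))) / real k < (\<integral>x. f x \<partial>\<nu>) + e"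
      by (rule order_tendstoD(2)[rotated])
    then show ?thesis
      by eventually_elim (use average_le_levels[of z X f k] z f k in \<open>auto intro: le_less_trans\<close>)
  qed
  have "((\<lambda>N. (\<Sum>n=1..N. f (z n)) / real N) \<longlongrightarrow> (\<integral>x. f x \<partial>\<nu>)) G"
    if f: "continuous_on X f" "\<And>x. x \<in> X \<Longrightarrow> 0 \<le> f x \<and> f x \<le> (1::real)" for f
  proof (rule tendstoI)
    fix e :: real assume e: "e > 0"
    have "integrable \<nu> f" using X f \<nu> by (intro integrable_continuous_on_compact)
    then have eq: "(\<integral>x. 1 - f x \<partial>\<nu>) = 1 - (\<integral>x. f x \<partial>\<nu>)" by (simp add: prob_space)
    have "\<forall>\<^sub>F N in G. (\<Sum>n=1..N. 1 - f (z n)) / real N < (\<integral>x. 1 - f x \<partial>\<nu>) + e"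
      using f e by (intro upper continuous_intros) auto
    moreover have "\<forall>\<^sub>F N in G. (\<Sum>n=1..N. f (z n)) / real N < (\<integral>x. f x \<partial>\<nu>) + e"
      using f e by (intro upper) auto
    ultimately show "\<forall>\<^sub>F N in G. dist ((\<Sum>n=1..N. f (z n)) / real N) (\<integral>x. f x \<partial>\<nu>) < e"
      using ev
      by eventually_elim (auto simp: eq dist_real_def sum_subtractf diff_divide_distrib abs_less_iff)
  qed
  then show ?thesis by (intro that[OF G lim \<nu> ge op]) auto
qed

text \<open>If convergence failed, averages along some filter would stay away from the integral. A
  limit measure \<open>\<nu>\<close> of the empirical distributions along a finer filter is shown to
  be invariant, hence equal to \<open>\<mu>\<close>, a contradiction.\<close>

lemma orbit_average_unit_interval:
  fixes X :: "'a::metric_space set" and T :: "'a \<Rightarrow> 'a" and f :: "'a \<Rightarrow> real"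
  assumes X: "compact X" and T: "continuous_on X T" "T ` X \<subseteq> X"
    and unique: "uniquely_ergodic X T" and \<mu>: "invariant_measure X T \<mu>"
    and x: "x \<in> X" and f: "continuous_on X f" "\<And>x. x \<in> X \<Longrightarrow> 0 \<le> f x \<and> f x \<le> 1"
  shows "(\<lambda>N. (\<Sum>n=1..N. f ((T ^^ num_prime_factors n) x)) / real N) \<longlonglongrightarrow> (\<integral>y. f y \<partial>\<mu>)"
proof (rule ccontr)
  define z where "z n = (T ^^ num_prime_factors n) x" for n
  have orbit: "(T ^^ k) x \<in> X" for k
    using x T(2) by (induction k) auto
  let ?D = "\<lambda>N. \<bar>(\<Sum>n=1..N. f (z n)) / real N - (\<integral>y. f y \<partial>\<mu>)\<bar>"
  assume "\<not> ?thesis"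
  then obtain \<eta> where \<eta>: "\<eta> > 0" and not_ev: "\<not> eventually (\<lambda>N. ?D N < \<eta>) sequentially"
    by (auto simp: tendsto_iff dist_real_def z_def)
  define F where "F = inf sequentially (principal {N. ?D N \<ge> \<eta>})"
  have F: "F \<noteq> bot"
    using not_ev unfolding F_def by (simp add: trivial_limit_def eventually_inf_principal not_le)
  have Fs: "F \<le> sequentially" by (simp add: F_def)
  have zX: "z n \<in> X" for n by (simp add: z_def orbit)
  obtain G m \<nu> where G: "G \<noteq> bot" "G \<le> F" and lim: "\<And>A. ((\<lambda>N. frequency z N A) \<longlongrightarrow> m A) G"
    and \<nu>: "sets \<nu> = sets (restrict_space borel X)" "prob_space \<nu>"
    and ge: "\<And>K. compact K \<Longrightarrow> K \<subseteq> X \<Longrightarrow> m K \<le> measure \<nu> K"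
    and op: "\<And>U e. open U \<Longrightarrow> e < measure \<nu> (U \<inter> X) \<Longrightarrow> \<exists>K. compact K \<and> K \<subseteq> U \<inter> X \<and> e < m K"
    and int: "\<forall>f. continuous_on X f \<longrightarrow> (\<forall>x\<in>X. 0 \<le> f x \<and> f x \<le> (1::real)) \<longrightarrow>
       ((\<lambda>N. (\<Sum>n=1..N. f (z n)) / real N) \<longlongrightarrow> (\<integral>x. f x \<partial>\<nu>)) G"
    by (rule empirical_cluster[where z = z, OF X zX F Fs]) (rule that)
  interpret N: prob_space \<nu> by fact
  have sp: "space \<nu> = X" using sets_eq_imp_space_eq[OF \<nu>(1)] by (simp add: space_restrict_space)
  \<comment> \<open>\<open>mean_shift_num_prime_factors\<close> is applied to the indicator of
    \<open>A\<close> along the orbit: raising the exponent by one means replacing \<open>A\<close>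
    by its preimage. No measurability of \<open>A\<close> enters.\<close>
  have m_inv: "m (T -` A \<inter> X) = m A" for A
  proof -
    let ?a = "\<lambda>k. indicator A ((T ^^ k) x) :: real"
    have "(\<lambda>N. mean (\<lambda>n. ?a (num_prime_factors n)) (real N) - mean (\<lambda>n. ?a (Suc (num_prime_factors n))) (real N)) \<longlonglongrightarrow> 0"
      by (rule mean_shift_num_prime_factors) (auto simp: indicator_def)
    moreover have "mean (\<lambda>n. ?a (num_prime_factors n)) (real N) = frequency z N A" for N
      by (simp add: mean_def frequency_def z_def)
    moreover have "mean (\<lambda>n. ?a (Suc (num_prime_factors n))) (real N) = frequency z N (T -` A \<inter> X)" for N
      using orbit by (simp add: mean_def frequency_def z_def indicator_def of_bool_def)
    ultimately have "((\<lambda>N. frequency z N A - frequency z N (T -` A \<inter> X)) \<longlongrightarrow> 0) G"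
      using G(2) Fs by (metis (no_types, lifting) ext order_trans tendsto_mono)
    moreover have "((\<lambda>N. frequency z N A - frequency z N (T -` A \<inter> X)) \<longlongrightarrow> m A - m (T -` A \<inter> X)) G"
      by (intro tendsto_diff lim)
    ultimately have "m A - m (T -` A \<inter> X) = 0" using G(1) by (metis tendsto_unique)
    then show ?thesis by simp
  qed
  have T_meas: "T \<in> measurable \<nu> borel"
    using borel_measurable_continuous_on_restrict[OF T(1)] measurable_cong_sets[OF \<nu>(1) refl] by blast
  have id_meas: "(\<lambda>y. y) \<in> measurable \<nu> borel"
    using borel_measurable_continuous_on_restrict[OF continuous_on_id[of X]] measurable_cong_sets[OF \<nu>(1) refl] 
    by (metis (no_types, lifting))
  \<comment> \<open>Invariance is known for \<open>m\<close> only. It passes to \<open>\<nu>\<close>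
    through a compact \<open>K\<close> inside \<open>U\<close> with large \<open>m K\<close>:
    \<open>m K\<close> equals \<open>m\<close> of the preimage of \<open>K\<close>, and on that
    compact set \<open>m\<close> is at most \<open>\<nu>\<close>.\<close>
  have le: "measure \<nu> (U \<inter> X) \<le> measure \<nu> (T -` U \<inter> X)" if U: "open U" for U
  proof (rule ccontr)
    assume "\<not> ?thesis"
    then obtain K where K: "compact K" "K \<subseteq> U \<inter> X" "measure \<nu> (T -` U \<inter> X) < m K"
      using op[OF U, of "measure \<nu> (T -` U \<inter> X)"] by (auto simp: not_le)
    have "closedin (top_of_set X) (X \<inter> T -` K)"
      using T(1) K(1) by (intro continuous_closedin_preimage compact_imp_closed)
    then have "compact (T -` K \<inter> X)" using X by (metis closedin_compact Int_commute)
    then have "m K \<le> measure \<nu> (T -` K \<inter> X)" using ge m_inv[of K] by (metis inf_le2)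
    also have "\<dots> \<le> measure \<nu> (T -` U \<inter> X)"
      using K U measurable_sets[OF T_meas, of U] sp by (intro N.finite_measure_mono) auto
    finally show False using K(3) by simp
  qed
  \<comment> \<open>Both measures are pushed forward to the Borel sets of the whole type, where one
    inequality on open sets already forces equality.\<close>
  have eq: "distr \<nu> borel (\<lambda>y. y) = distr \<nu> borel T"
  proof (rule measure_eqI_open_le)
    show "prob_space (distr \<nu> borel (\<lambda>y. y))" "prob_space (distr \<nu> borel T)"
      using id_meas T_meas by (auto intro: N.prob_space_distr)
    show "measure (distr \<nu> borel (\<lambda>y. y)) U \<le> measure (distr \<nu> borel T) U" if "open U" for U
      using le[OF that] that id_meas T_meas sp by (simp add: measure_distr)
  qed auto
  have "invariant_measure X T \<nu>"
    unfolding invariant_measure_def borel_prob_measure_on_def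
  proof (intro conjI ballI \<nu>)
    fix A assume "A \<in> sets (restrict_space borel X)"
    then obtain B where B: "B \<in> sets borel" "A = X \<inter> B" by (auto simp: sets_restrict_space)
    have "measure \<nu> (T -` A \<inter> X) = measure (distr \<nu> borel T) B"
      using B T_meas T(2) sp by (subst measure_distr) (auto intro!: arg_cong[of _ _ "measure \<nu>"])
    also have "\<dots> = measure (distr \<nu> borel (\<lambda>y. y)) B" by (simp only: eq)
    also have "\<dots> = measure \<nu> A"
      using B id_meas sp by (subst measure_distr) (auto simp: Int_commute)
    finally show "measure \<nu> (T -` A \<inter> X) = measure \<nu> A" .
  qed
  then have "\<nu> = \<mu>" using unique \<mu> unfolding uniquely_ergodic_def by blast
  then have "((\<lambda>N. ?D N) \<longlongrightarrow> \<bar>(\<integral>y. f y \<partial>\<mu>) - (\<integral>y. f y \<partial>\<mu>)\<bar>) G"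
    using int f by (intro tendsto_intros) auto
  moreover have "\<forall>\<^sub>F N in G. \<eta> \<le> ?D N"
    using G(2) by (rule filter_leD) (simp add: F_def eventually_inf_principal)
  ultimately have "\<eta> \<le> \<bar>(\<integral>y. f y \<partial>\<mu>) - (\<integral>y. f y \<partial>\<mu>)\<bar>"
    using G(1) by (rule tendsto_lowerbound)
  with \<eta> show False by simp
qed

lemma orbit_average_real:
  fixes X :: "'a::metric_space set" and T :: "'a \<Rightarrow> 'a" and f :: "'a \<Rightarrow> real"
  assumes X: "compact X" and T: "continuous_on X T" "T ` X \<subseteq> X"
    and unique: "uniquely_ergodic X T" and \<mu>: "invariant_measure X T \<mu>"
    and x: "x \<in> X" and f: "continuous_on X f"
  shows "(\<lambda>N. (\<Sum>n=1..N. f ((T ^^ num_prime_factors n) x)) / real N) \<longlonglongrightarrow> (\<integral>y. f y \<partial>\<mu>)"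
proof -
  have \<mu>': "sets \<mu> = sets (restrict_space borel X)" "prob_space \<mu>"
    using \<mu> by (auto simp: invariant_measure_def borel_prob_measure_on_def)
  interpret prob_space \<mu> by fact
  obtain B where B: "B > 0" "\<And>y. y \<in> X \<Longrightarrow> \<bar>f y\<bar> \<le> B"
    using compact_imp_bounded[OF compact_continuous_image[OF f X]] by (auto simp: bounded_pos)
  \<comment> \<open>An affine rescaling of \<open>f\<close> into \<open>[0, 1]\<close>; the average
    and the integral against a probability measure are transformed in the same way.\<close>
  define g where "g y = (f y + B) / (2 * B)" for y
  have "continuous_on X g" unfolding g_def using f B by (intro continuous_intros) auto
  moreover have "0 \<le> g y \<and> g y \<le> 1" if "y \<in> X" for y
    using B(1) B(2)[OF that] by (auto simp: g_def field_simps abs_le_iff)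
  ultimately have "(\<lambda>N. (\<Sum>n=1..N. g ((T ^^ num_prime_factors n) x)) / real N) \<longlonglongrightarrow> (\<integral>y. g y \<partial>\<mu>)"
    using orbit_average_unit_interval[OF X T unique \<mu> x] by blast
  then have "(\<lambda>N. 2 * B * ((\<Sum>n=1..N. g ((T ^^ num_prime_factors n) x)) / real N) - B)
      \<longlonglongrightarrow> 2 * B * (\<integral>y. g y \<partial>\<mu>) - B"
    by (intro tendsto_intros)
  moreover have "integrable \<mu> f" using X f \<mu>' by (intro integrable_continuous_on_compact)
  then have "2 * B * (\<integral>y. g y \<partial>\<mu>) - B = (\<integral>y. f y \<partial>\<mu>)"
    using B(1) by (simp add: g_def prob_space)
  \<comment> \<open>The identity fails at \<open>N = 0\<close>, where the left side is
    \<open>- B\<close>, so it is stated only eventually.\<close>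
  moreover have "\<forall>\<^sub>F N in sequentially. 2 * B * ((\<Sum>n=1..N. g ((T ^^ num_prime_factors n) x)) / real N) - B
      = (\<Sum>n=1..N. f ((T ^^ num_prime_factors n) x)) / real N"
    using eventually_ge_at_top[of 1]
    by eventually_elim (use B(1) in \<open>simp add: g_def sum.distrib sum_divide_distrib[symmetric] field_simps\<close>)
  ultimately show ?thesis by (auto elim: Lim_transform_eventually)
qed

theorem theoremA:
  fixes X :: "'a::metric_space set" and T :: "'a \<Rightarrow> 'a" and \<mu> :: "'a measure"
    and f :: "'a \<Rightarrow> complex" and x :: 'a
  assumes "compact X"
    and "continuous_on X T" and "T ` X \<subseteq> X"
    and "uniquely_ergodic X T" and "invariant_measure X T \<mu>"
    and "x \<in> X" and "continuous_on X f"
  shows "(\<lambda>N::nat. (1 / of_nat N) * (\<Sum>n=1..N. f ((T ^^ num_prime_factors n) x)))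
           \<longlonglongrightarrow> (\<integral>y. f y \<partial>\<mu>)"
proof -
  have "integrable \<mu> f"
    using assms by (intro integrable_continuous_on_compact)
      (auto simp: invariant_measure_def borel_prob_measure_on_def)
  then have int: "(\<integral>y. Re (f y) \<partial>\<mu>) = Re (\<integral>y. f y \<partial>\<mu>)" "(\<integral>y. Im (f y) \<partial>\<mu>) = Im (\<integral>y. f y \<partial>\<mu>)"
    by (rule integral_Re, rule integral_Im)
  have "(\<lambda>N. (\<Sum>n=1..N. Re (f ((T ^^ num_prime_factors n) x))) / real N) \<longlonglongrightarrow> (\<integral>y. Re (f y) \<partial>\<mu>)"
    using assms by (intro orbit_average_real continuous_intros)
  moreover have "(\<lambda>N. (\<Sum>n=1..N. Im (f ((T ^^ num_prime_factors n) x))) / real N) \<longlonglongrightarrow> (\<integral>y. Im (f y) \<partial>\<mu>)"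
    using assms by (intro orbit_average_real continuous_intros)
  ultimately show ?thesis
    unfolding tendsto_complex_iff int by (simp add: Re_divide_of_nat Im_divide_of_nat)
qed

end
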